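(* There exist a constant $c$ and a (randomized) polynomial-time $c(\Delta+1)\log n$-approximation algorithm that solves the 1-round TCAND problem with high probability. Here, for an input $(V,\mathcal{F},T)$, $n=|V|$, $\mathcal{LS}=\{LS\subseteq V: (LS\to i)\in\mathcal{F}\text{ for some } i\in V\}$ and $\Delta=\max_{LS\in\mathcal{LS}}|\{LS'\in\mathcal{LS}: LS\cap LS'\neq\emptyset\}|$.
   Context: Let $V=[n]=\{1,\dots,n\}$ be a finite set of attributes (variables). A functional dependency (FD) over $V$ is an expression $LS\to i$ with $LS\subseteq V$ and $i\in V$ (an FD with several attributes on the right-hand side is identified with the corresponding set of FDs with single-attribute right-hand sides). $\mathcal{F}$ is a finite set of FDs and $T\subseteq V$ is a set of target variables. 1-round TCAND: find a set $X\subseteq V$ of minimum cardinality such that the one-step closure of $X$ contains $T$; the one-step closure of $X$ is $X\cup\{i\in V: \exists (LS\to i)\in\mathcal{F},\ LS\subseteq X\}$. Such a set $X$ is called feasible, and $\mathrm{OPT}$ denotes the minimum cardinality of a feasible set. A randomized algorithm is a $\rho$-approximation with high probability if with probability $1-o(1)$ (as $n\to\infty$) its output is feasible and has cardinality at most $\rho\cdot\mathrm{OPT}$. *)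

theory Defs
  imports "HOL-Probability.Probability" "HOL-Computational_Algebra.Polynomial"
begin

section \<open>One-round TCAND\<close>

text \<open>The pair \<open>(L, i)\<close> is the functional dependency \<open>L \<rightarrow> i\<close>; the attributes are \<open>{1..n}\<close>.\<close>

type_synonym fd = "nat set \<times> nat"

definition tcand_instance :: "nat \<Rightarrow> fd set \<Rightarrow> nat set \<Rightarrow> bool" where
  "tcand_instance n F T \<longleftrightarrow>
     finite F \<and> (\<forall>(L, i) \<in> F. L \<subseteq> {1..n} \<and> i \<in> {1..n}) \<and> T \<subseteq> {1..n}"

definition one_step_closure :: "nat \<Rightarrow> fd set \<Rightarrow> nat set \<Rightarrow> nat set" where
  "one_step_closure n F X = X \<union> {i \<in> {1..n}. \<exists>L. (L, i) \<in> F \<and> L \<subseteq> X}"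

definition feasible :: "nat \<Rightarrow> fd set \<Rightarrow> nat set \<Rightarrow> nat set \<Rightarrow> bool" where
  "feasible n F T X \<longleftrightarrow> X \<subseteq> {1..n} \<and> T \<subseteq> one_step_closure n F X"

definition OPT :: "nat \<Rightarrow> fd set \<Rightarrow> nat set \<Rightarrow> nat" where
  "OPT n F T = Min (card ` {X. feasible n F T X})"

definition left_sides :: "fd set \<Rightarrow> nat set set" where
  "left_sides F = {L. \<exists>i. (L, i) \<in> F}"

text \<open>Inserting \<open>0\<close> only matters if there are no dependencies, where the maximum is read as 0.
  A nonempty left side meets itself and is counted.\<close>

definition Delta :: "fd set \<Rightarrow> nat" where
  "Delta F = Max (insert 0 ((\<lambda>L. card {L' \<in> left_sides F. L \<inter> L' \<noteq> {}}) ` left_sides F))"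


section \<open>Randomized algorithms\<close>

text \<open>
  Algorithms are programs of the random access machine of Cook and Reckhow (\<^emph>\<open>Time bounded
  random access machines\<close>, 1973), over natural numbers with truncated subtraction, extended
  by a fair coin toss.  Every instruction costs one time unit. As sums and differences are the
  only arithmetic, a step lengthens the largest stored number by at most one bit, so
  polynomial time on this machine is polynomial time on a probabilistic Turing machine.

  \<open>Load i j\<close> is \<open>X\<^sub>i := X\<^bsub>X\<^sub>j\<^esub>\<close>, \<open>Store i j\<close> is \<open>X\<^bsub>X\<^sub>i\<^esub> := X\<^sub>j\<close>, and \<open>Jump_Pos m j\<close> jumps to the absolute
  position \<open>m\<close> if \<open>X\<^sub>j > 0\<close>.  \<open>Read\<close> delivers 0 once the input is exhausted.
  A machine halts by leaving the program text.
\<close>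

datatype instr =
    Const nat nat
  | Add nat nat nat
  | Sub nat nat nat
  | Load nat nat
  | Store nat nat
  | Jump_Pos nat nat
  | Read nat
  | Print nat
  | Coin nat

type_synonym program = "instr list"

record config =
  pc :: nat
  mem :: "nat \<Rightarrow> nat"
  inp :: "nat list"
  out :: "nat list"

definition initial :: "nat list \<Rightarrow> config" where
  "initial w = \<lparr>pc = 0, mem = (\<lambda>_. 0), inp = w, out = []\<rparr>"

definition halted :: "program \<Rightarrow> config \<Rightarrow> bool" where
  "halted P s \<longleftrightarrow> length P \<le> pc s"

definition set_reg :: "nat \<Rightarrow> nat \<Rightarrow> config \<Rightarrow> config" where
  "set_reg i x s = s\<lparr>pc := Suc (pc s), mem := (mem s)(i := x)\<rparr>"

fun exec :: "instr \<Rightarrow> config \<Rightarrow> config pmf" where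
  "exec (Const i k) s = return_pmf (set_reg i k s)"
| "exec (Add i j k) s = return_pmf (set_reg i (mem s j + mem s k) s)"
| "exec (Sub i j k) s = return_pmf (set_reg i (mem s j - mem s k) s)"
| "exec (Load i j) s = return_pmf (set_reg i (mem s (mem s j)) s)"
| "exec (Store i j) s = return_pmf (set_reg (mem s i) (mem s j) s)"
| "exec (Jump_Pos m j) s = return_pmf (s\<lparr>pc := if mem s j > 0 then m else Suc (pc s)\<rparr>)"
| "exec (Read i) s =
     return_pmf (set_reg i (case inp s of [] \<Rightarrow> 0 | x # _ \<Rightarrow> x) (s\<lparr>inp := tl (inp s)\<rparr>))"
| "exec (Print i) s = return_pmf (s\<lparr>pc := Suc (pc s), out := out s @ [mem s i]\<rparr>)"
| "exec (Coin i) s = map_pmf (\<lambda>b. set_reg i (if b then 1 else 0) s) (bernoulli_pmf (1/2))"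

definition step :: "program \<Rightarrow> config \<Rightarrow> config pmf" where
  "step P s = (if halted P s then return_pmf s else exec (P ! pc s) s)"

primrec run :: "program \<Rightarrow> nat \<Rightarrow> config \<Rightarrow> config pmf" where
  "run P 0 s = return_pmf s"
| "run P (Suc t) s = bind_pmf (step P s) (run P t)"

text \<open>The time bound is a worst-case one: it holds for all outcomes of the coin tosses.\<close>

definition halts_within :: "program \<Rightarrow> nat list \<Rightarrow> nat \<Rightarrow> bool" where
  "halts_within P w t \<longleftrightarrow> (\<forall>s \<in> set_pmf (run P t (initial w)). halted P s)"

definition polynomial_time_on :: "nat list set \<Rightarrow> program \<Rightarrow> bool" where
  "polynomial_time_on W P \<longleftrightarrow> (\<exists>p :: nat poly. \<forall>w \<in> W. halts_within P w (poly p (length w)))"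

text \<open>Only meaningful if \<open>P\<close> halts on \<open>w\<close> within some fixed number of steps. Halted
  configurations do not change, so any such number gives the same distribution.\<close>

definition output_distribution :: "program \<Rightarrow> nat list \<Rightarrow> nat list pmf" where
  "output_distribution P w = map_pmf out (run P (LEAST t. halts_within P w t) (initial w))"


section \<open>Randomized approximation of one-round TCAND\<close>

text \<open>An instance is given by \<open>n\<close>, the number of dependencies, the characteristic vector of \<open>T\<close>,
  and, for each dependency, its right side followed by the characteristic vector of its left side.\<close>

definition char_vector :: "nat \<Rightarrow> nat set \<Rightarrow> nat list" where
  "char_vector n A = map (\<lambda>i. if i \<in> A then 1 else 0) [1..<Suc n]"

definition encode :: "nat \<Rightarrow> fd list \<Rightarrow> nat set \<Rightarrow> nat list" where
  "encode n fs T =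
     [n, length fs] @ char_vector n T @ concat (map (\<lambda>(L, i). i # char_vector n L) fs)"

text \<open>The set of dependencies may be listed in any order.\<close>

definition encodings :: "nat \<Rightarrow> fd set \<Rightarrow> nat set \<Rightarrow> nat list set" where
  "encodings n F T = {encode n fs T | fs. distinct fs \<and> set fs = F}"

definition tcand_inputs :: "nat list set" where
  "tcand_inputs = (\<Union>(n, F, T) \<in> {(n, F, T). tcand_instance n F T}. encodings n F T)"

text \<open>The numbers in an encoding are bounded by its length, so polynomial in the number of words
  and polynomial in the number of bits are the same.\<close>

lemma length_encode: "length (encode n fs T) = 2 + n + length fs * (n + 1)"
  by (induction fs) (auto simp: encode_def char_vector_def algebra_simps)

lemma encode_le_length:
  assumes "w \<in> tcand_inputs" "x \<in> set w"
  shows "x \<le> length w"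
proof -
  obtain n T fs where w: "w = encode n fs T" and inst: "tcand_instance n (set fs) T"
    using assms(1) by (auto simp: tcand_inputs_def encodings_def)
  have "x \<le> max n (max 1 (length fs))"
    using assms(2) inst
    by (fastforce simp: w encode_def char_vector_def tcand_instance_def split: if_splits)
  then show ?thesis
    unfolding w length_encode by (auto simp: max_def split: if_splits)
qed

definition whp_approximation ::
    "(nat \<Rightarrow> fd set \<Rightarrow> nat set \<Rightarrow> real) \<Rightarrow> program \<Rightarrow> bool" where
  "whp_approximation \<rho> P \<longleftrightarrow>
     (\<exists>\<delta> :: nat \<Rightarrow> real. \<delta> \<longlonglongrightarrow> 0 \<and>
       (\<forall>n F T. tcand_instance n F T \<longrightarrow> (\<forall>w \<in> encodings n F T.
          measure_pmf.prob (output_distribution P w)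
            {xs. feasible n F T (set xs) \<and> real (card (set xs)) \<le> \<rho> n F T * real (OPT n F T)}
          \<ge> 1 - \<delta> n)))"

end

theory Submission
  imports Defs
begin

text \<open>
  The algorithm is the greedy heuristic for weighted set cover, so no coin is tossed. The targets are
  covered by the sets \<open>{i. L \<rightarrow> i}\<close>, of cost \<open>|L|\<close>, and by singletons, of cost 1. An attribute
  lies in at most \<open>\<Delta>\<close> left sides, hence the left sides inside an optimal solution \<open>X\<close> cost at most
  \<open>\<Delta> |X|\<close> together, and the optimal cover costs at most \<open>(\<Delta> + 1) OPT\<close>. Greedy loses a
  factor \<open>ln n + O(1)\<close> against it. As ratios only get worse, the singletons may be left to the end:
  first left sides are bought while one covers more targets than it costs, always one with the best
  ratio; then the remaining targets are bought themselves.

  The machine program is compiled from a language with counted loops, for which a polynomial time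
  bound can be read off the syntax.
\<close>

section \<open>A loop language\<close>

abbreviation (input) "R_one \<equiv> 2 :: nat"

text \<open>\<open>For r c\<close> runs \<open>c\<close> as often as register \<open>r\<close> says, counting \<open>r\<close> down to \<open>0\<close>.  For
  a flag \<open>r\<close> it is a conditional.  The compiled code needs the constant 1 in \<open>R_one\<close>.\<close>

datatype com = Blk "instr list" | Seq com com (infixr ";;" 60) | For nat com

type_synonym assn = "(nat \<Rightarrow> nat) \<Rightarrow> nat list \<Rightarrow> nat list \<Rightarrow> bool"

primrec code_length :: "com \<Rightarrow> nat" where
  "code_length (Blk is) = length is"
| "code_length (c1 ;; c2) = code_length c1 + code_length c2"
| "code_length (For r c) = code_length c + 4"

text \<open>Jump targets are absolute, hence the start address \<open>a\<close>. The first jump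
  enters the body while the counter is positive, the second leaves the loop. As \<open>R_one\<close>
  holds 1, jumping on it is unconditional.\<close>

primrec compile :: "com \<Rightarrow> nat \<Rightarrow> program" where
  "compile (Blk is) a = is"
| "compile (c1 ;; c2) a = compile c1 a @ compile c2 (a + code_length c1)"
| "compile (For r c) a =
     [Jump_Pos (a + 2) r, Jump_Pos (a + code_length c + 4) R_one] @ compile c (a + 2) @
     [Sub r r R_one, Jump_Pos a R_one]"

lemma length_compile [simp]: "length (compile c a) = code_length c"
  by (induction c arbitrary: a) auto

text \<open>The argument of the polynomial is a bound on all loop counters; that they obey it is part of
  \<open>wp\<close> below.\<close>

primrec time_bound :: "com \<Rightarrow> nat poly" where
  "time_bound (Blk is) = [:length is:]"
| "time_bound (c1 ;; c2) = time_bound c1 + time_bound c2"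
| "time_bound (For r c) = [:0, 1:] * (time_bound c + [:3:]) + [:2:]"

section \<open>Weakest preconditions\<close>

fun wp_instr :: "instr \<Rightarrow> assn \<Rightarrow> assn" where
  "wp_instr (Const r k) Q m i o' = Q (m(r := k)) i o'"
| "wp_instr (Add r j k) Q m i o' = Q (m(r := m j + m k)) i o'"
| "wp_instr (Sub r j k) Q m i o' = Q (m(r := m j - m k)) i o'"
| "wp_instr (Load r j) Q m i o' = Q (m(r := m (m j))) i o'"
| "wp_instr (Store r j) Q m i o' = Q (m(m r := m j)) i o'"
| "wp_instr (Read r) Q m i o' = Q (m(r := case i of [] \<Rightarrow> 0 | x # _ \<Rightarrow> x)) (tl i) o'"
| "wp_instr (Print r) Q m i o' = Q m i (o' @ [m r])"
| "wp_instr (Jump_Pos _ _) Q m i o' = False"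
| "wp_instr (Coin _) Q m i o' = False"

primrec wp_block :: "instr list \<Rightarrow> assn \<Rightarrow> assn" where
  "wp_block [] Q = Q"
| "wp_block (x # xs) Q = wp_instr x (wp_block xs Q)"

text \<open>The code behind the body decrements \<open>r\<close> and jumps back on
  \<open>R_one\<close>. So a pass has to end with the counter at its old value \<open>k\<close> and
  with \<open>R_one\<close> at 1; \<open>R\<close> speaks of the memory after the decrement.\<close>

definition loop_post :: "nat \<Rightarrow> nat \<Rightarrow> assn \<Rightarrow> assn" where
  "loop_post r k R m i o' \<longleftrightarrow> m r = k \<and> m R_one = 1 \<and> R (m(r := k - 1)) i o'"

definition wp_iter :: "nat \<Rightarrow> (assn \<Rightarrow> assn) \<Rightarrow> assn \<Rightarrow> assn" where
  "wp_iter r W R m = W (loop_post r (m r) R) m"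

text \<open>The number of passes is fixed on entry, so a loop is a finite iterate and needs no fixed
  point. \<open>N\<close> bounds every counter on entry; the time bound rests on this.\<close>

primrec wp :: "nat \<Rightarrow> com \<Rightarrow> assn \<Rightarrow> assn" where
  "wp N (Blk is) Q = wp_block is Q"
| "wp N (c1 ;; c2) Q = wp N c1 (wp N c2 Q)"
| "wp N (For r c) Q = (\<lambda>m i o'. m r \<le> N \<and> m R_one = 1 \<and>
     (wp_iter r (wp N c) ^^ m r) (\<lambda>m i o'. m r = 0 \<and> m R_one = 1 \<and> Q m i o') m i o')"

lemma wp_instr_mono:
  "wp_instr x Q m i o' \<Longrightarrow> (\<And>m i o'. Q m i o' \<Longrightarrow> Q' m i o') \<Longrightarrow> wp_instr x Q' m i o'"
  by (cases x) auto

lemma wp_block_mono: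
  "wp_block xs Q m i o' \<Longrightarrow> (\<And>m i o'. Q m i o' \<Longrightarrow> Q' m i o') \<Longrightarrow> wp_block xs Q' m i o'"
proof (induction xs arbitrary: m i o')
  case (Cons x xs)
  then show ?case using wp_instr_mono[of x "wp_block xs Q" m i o' "wp_block xs Q'"] by simp
qed simp

lemma wp_mono:
  "wp N c Q m i o' \<Longrightarrow> (\<And>m i o'. Q m i o' \<Longrightarrow> Q' m i o') \<Longrightarrow> wp N c Q' m i o'"
proof (induction c arbitrary: Q Q' m i o')
  case (Blk x)
  then show ?case using wp_block_mono[of x Q m i o' Q'] by simp
next
  case (Seq c1 c2)
  have "wp N c1 (wp N c2 Q') m i o'"
    by (rule Seq.IH(1)[of "wp N c2 Q"]) (use Seq in auto)
  then show ?case by simp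
next
  case (For r c)
  define B where "B = wp_iter r (wp N c)"
  have B_iff: "B R m i o' \<longleftrightarrow> wp N c (loop_post r (m r) R) m i o'" for R m i o'
    unfolding B_def wp_iter_def ..
  have "(B ^^ k) Q1 m i o' \<Longrightarrow> (\<And>m i o'. Q1 m i o' \<Longrightarrow> Q2 m i o') \<Longrightarrow> (B ^^ k) Q2 m i o'"
    for k Q1 Q2 m i o'
  proof (induction k arbitrary: m i o')
    case (Suc k)
    have "B ((B ^^ k) Q1) m i o'" using Suc.prems(1) by simp
    then have "wp N c (loop_post r (m r) ((B ^^ k) Q1)) m i o'" unfolding B_iff .
    then have "wp N c (loop_post r (m r) ((B ^^ k) Q2)) m i o'"
    proof (rule For.IH)
      fix m' i' o''
      assume "loop_post r (m r) ((B ^^ k) Q1) m' i' o''"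
      then show "loop_post r (m r) ((B ^^ k) Q2) m' i' o''"
        unfolding loop_post_def using Suc.IH[OF _ Suc.prems(2)] by blast
    qed
    then have "B ((B ^^ k) Q2) m i o'"
      by (rule B_iff[of "(B ^^ k) Q2" m i o', THEN iffD2])
    then show ?case by simp
  qed simp
  from this[of "m r" _ m i o'] For.prems show ?case by (auto simp: B_def)
qed

text \<open>\<open>I k\<close> describes the state after \<open>k\<close> passes, with the counter
  already decremented: the index rises while the register falls from \<open>T\<close> to 0. This is
  why the body is judged at \<open>m'(r := T - Suc k)\<close>.\<close>

lemma wp_For:
  assumes "m r = T" "T \<le> N" "m R_one = 1" "I 0 m i o'"
    and step: "\<And>k m i o'. k < T \<Longrightarrow> I k m i o' \<Longrightarrow> m r = T - k \<Longrightarrow> m R_one = 1 \<Longrightarrow>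
      wp N c (\<lambda>m' i' o''. m' r = T - k \<and> m' R_one = 1 \<and> I (Suc k) (m'(r := T - Suc k)) i' o'') m i o'"
    and post: "\<And>m i o'. I T m i o' \<Longrightarrow> m r = 0 \<Longrightarrow> m R_one = 1 \<Longrightarrow> Q m i o'"
    and "r \<noteq> R_one"
  shows "wp N (For r c) Q m i o'"
proof -
  define B where "B = wp_iter r (wp N c)"
  have B_iff: "B R m i o' \<longleftrightarrow> wp N c (loop_post r (m r) R) m i o'" for R m i o'
    unfolding B_def wp_iter_def ..
  define E where "E = (\<lambda>m i o'. m r = 0 \<and> m R_one = 1 \<and> Q m i o')"
  have "k \<le> T \<Longrightarrow> I (T - k) m i o' \<Longrightarrow> m r = k \<Longrightarrow> m R_one = 1 \<Longrightarrow> (B ^^ k) E m i o'" for k m i o'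
  proof (induction k arbitrary: m i o')
    case 0
    then show ?case using post assms(7) by (simp add: E_def)
  next
    case (Suc k)
    have 1: "wp N c (\<lambda>m' i' o''. m' r = Suc k \<and> m' R_one = 1 \<and> I (T - k) (m'(r := k)) i' o'') m i o'"
      using step[of "T - Suc k" m i o'] Suc.prems by (simp add: Suc_diff_Suc)
    have "B ((B ^^ k) E) m i o'"
    proof (rule B_iff[of "(B ^^ k) E" m i o', THEN iffD2], rule wp_mono[OF 1], elim conjE)
      fix m' i' o'' assume *: "m' r = Suc k" "m' R_one = 1" "I (T - k) (m'(r := k)) i' o''"
      have "(B ^^ k) E (m'(r := k)) i' o''"
        by (rule Suc.IH) (use * Suc.prems(1) assms(7) in \<open>simp_all del: fun_upd_apply add: fun_upd_same fun_upd_other\<close>)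
      then show "loop_post r (m r) ((B ^^ k) E) m' i' o''"
        using * Suc.prems(3) by (simp add: loop_post_def del: fun_upd_apply)
    qed
    then show ?case by simp
  qed
  from this[of T m i o'] assms show ?thesis by (simp add: B_def E_def)
qed

text \<open>The loop makes no pass or one, and in both cases the flag is 0 afterwards.\<close>

lemma wp_If:
  assumes "m r \<le> 1" "N \<ge> 1" "m R_one = 1" "r \<noteq> R_one"
    and "m r = 1 \<Longrightarrow> wp N c (\<lambda>m' i' o''. m' r = 1 \<and> m' R_one = 1 \<and> Q (m'(r := 0)) i' o'') m i o'"
    and "m r = 0 \<Longrightarrow> Q m i o'"
  shows "wp N (For r c) Q m i o'"
proof (cases "m r = 0")
  case False
  then have 1: "m r = 1" using assms(1) by simp
  from assms(5)[OF 1]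
  have "wp N c (loop_post r 1 (\<lambda>m i o'. m r = 0 \<and> m R_one = 1 \<and> Q m i o')) m i o'"
    by (rule wp_mono) (use assms(4) in \<open>simp add: loop_post_def\<close>)
  then show ?thesis using 1 assms(2,3) by (simp add: wp_iter_def)
qed (use assms in simp)

section \<open>Running compiled code\<close>

definition code_at :: "program \<Rightarrow> nat \<Rightarrow> program \<Rightarrow> bool" where
  "code_at P a xs \<longleftrightarrow> (\<exists>pre post. P = pre @ xs @ post \<and> length pre = a)"

lemma code_at_append:
  "code_at P a (xs @ ys) \<Longrightarrow> code_at P a xs \<and> code_at P (a + length xs) ys"
  unfolding code_at_def by (metis append.assoc length_append)

lemma code_at_Cons:
  "code_at P a (x # xs) \<Longrightarrow> P ! a = x \<and> a < length P \<and> code_at P (Suc a) xs"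
proof -
  assume "code_at P a (x # xs)"
  then obtain pre post where P: "P = pre @ (x # xs) @ post" "length pre = a"
    unfolding code_at_def by blast
  have "P = (pre @ [x]) @ xs @ post \<and> length (pre @ [x]) = Suc a" using P by simp
  then have "code_at P (Suc a) xs" unfolding code_at_def by blast
  then show ?thesis using P by (simp add: nth_append)
qed

lemma run_add: "run P (t + u) s = bind_pmf (run P t s) (run P u)"
proof (induction t arbitrary: s)
  case (Suc t)
  have "run P (t + u) = (\<lambda>s. bind_pmf (run P t s) (run P u))"
    by (rule ext) (rule Suc.IH)
  then show ?case by (simp add: bind_assoc_pmf)
qed (simp add: bind_return_pmf)

text \<open>Jumps and coin tosses have the precondition \<open>False\<close>; all other instructions
  are deterministic and proceed to the next position.\<close>

lemma wp_instr_exec: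
  assumes "wp_instr x Q m i o'"
  shows "\<exists>m' i' o''. Q m' i' o'' \<and>
    exec x \<lparr>pc = a, mem = m, inp = i, out = o'\<rparr> =
      return_pmf \<lparr>pc = Suc a, mem = m', inp = i', out = o''\<rparr>"
  using assms by (cases x) (auto simp: set_reg_def)

lemma wp_block_run:
  assumes "wp_block xs Q m i o'" "code_at P a xs"
  shows "\<exists>m' i' o''. Q m' i' o'' \<and>
    run P (length xs) \<lparr>pc = a, mem = m, inp = i, out = o'\<rparr> =
      return_pmf \<lparr>pc = a + length xs, mem = m', inp = i', out = o''\<rparr>"
  using assms
proof (induction xs arbitrary: m i o' a)
  case (Cons x xs)
  have "P ! a = x" "a < length P" "code_at P (Suc a) xs"
    using code_at_Cons Cons.prems(2) by blast+
  moreover obtain m1 i1 o1 where "wp_block xs Q m1 i1 o1"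
    "exec x \<lparr>pc = a, mem = m, inp = i, out = o'\<rparr> =
      return_pmf \<lparr>pc = Suc a, mem = m1, inp = i1, out = o1\<rparr>"
    using wp_instr_exec Cons.prems(1) by (metis wp_block.simps(2))
  ultimately show ?case using Cons.IH[of m1 i1 o1 "Suc a"]
    by (simp add: step_def halted_def bind_return_pmf)
qed simp

lemma run_Jump_Pos:
  assumes "code_at P a [Jump_Pos l r]"
  shows "run P 1 \<lparr>pc = a, mem = m, inp = i, out = o'\<rparr> =
    return_pmf \<lparr>pc = if m r > 0 then l else Suc a, mem = m, inp = i, out = o'\<rparr>"
  using code_at_Cons[OF assms] by (simp add: step_def halted_def bind_return_pmf bind_return_pmf')

lemma run_Sub:
  assumes "code_at P a [Sub r j k]"
  shows "run P 1 \<lparr>pc = a, mem = m, inp = i, out = o'\<rparr> =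
    return_pmf \<lparr>pc = Suc a, mem = m(r := m j - m k), inp = i, out = o'\<rparr>"
  using code_at_Cons[OF assms]
  by (simp add: step_def halted_def bind_return_pmf bind_return_pmf' set_reg_def)

lemma run_trans:
  "run P t s = return_pmf s' \<Longrightarrow> run P u s' = return_pmf s'' \<Longrightarrow> run P (t + u) s = return_pmf s''"
  by (simp add: run_add bind_return_pmf)

text \<open>By induction on the command. Besides its body, a pass of a loop costs 3 steps: the
  entering jump, the decrement and the jump back. Leaving the loop costs 2 steps.\<close>

lemma wp_run:
  assumes "wp N c Q m i o'" "code_at P a (compile c a)"
  shows "\<exists>t \<le> poly (time_bound c) N. \<exists>m' i' o''. Q m' i' o'' \<and>
    run P t \<lparr>pc = a, mem = m, inp = i, out = o'\<rparr> =
      return_pmf \<lparr>pc = a + code_length c, mem = m', inp = i', out = o''\<rparr>"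
  using assms
proof (induction c arbitrary: Q m i o' a)
  case (Blk xs)
  then show ?case using wp_block_run[of xs Q m i o' P a] by auto
next
  case (Seq c1 c2)
  have c: "code_at P a (compile c1 a)" "code_at P (a + code_length c1) (compile c2 (a + code_length c1))"
    using code_at_append[of P a "compile c1 a"] Seq.prems(2) by auto
  obtain t1 m1 i1 o1 where 1: "t1 \<le> poly (time_bound c1) N" "wp N c2 Q m1 i1 o1"
    "run P t1 \<lparr>pc = a, mem = m, inp = i, out = o'\<rparr> =
      return_pmf \<lparr>pc = a + code_length c1, mem = m1, inp = i1, out = o1\<rparr>"
    using Seq.IH(1)[OF _ c(1), of "wp N c2 Q" m i o'] Seq.prems(1) by auto
  obtain t2 m2 i2 o2 where 2: "t2 \<le> poly (time_bound c2) N" "Q m2 i2 o2"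
    "run P t2 \<lparr>pc = a + code_length c1, mem = m1, inp = i1, out = o1\<rparr> =
      return_pmf \<lparr>pc = a + code_length c1 + code_length c2, mem = m2, inp = i2, out = o2\<rparr>"
    using Seq.IH(2)[OF 1(2) c(2)] by auto
  show ?case
    using run_trans[OF 1(3) 2(3)] 1(1) 2(1,2)
    by (intro exI[of _ "t1 + t2"]) (auto simp: add.assoc)
next
  case (For r c)
  define B where "B = wp_iter r (wp N c)"
  have B_iff: "B R m i o' \<longleftrightarrow> wp N c (loop_post r (m r) R) m i o'" for R m i o'
    unfolding B_def wp_iter_def ..
  define E where "E = (\<lambda>m i o'. m r = 0 \<and> m R_one = 1 \<and> Q m i o')"
  let ?e = "a + code_length c + 4"
  have code: "code_at P a [Jump_Pos (a + 2) r]" "code_at P (Suc a) [Jump_Pos ?e R_one]"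
    "code_at P (a + 2) (compile c (a + 2))"
    "code_at P (a + 2 + code_length c) [Sub r r R_one]"
    "code_at P (a + 3 + code_length c) [Jump_Pos a R_one]"
    using For.prems(2)
      code_at_append[of P a "[Jump_Pos (a + 2) r]"
        "[Jump_Pos ?e R_one] @ compile c (a + 2) @ [Sub r r R_one] @ [Jump_Pos a R_one]"]
      code_at_append[of P "Suc a" "[Jump_Pos ?e R_one]"
        "compile c (a + 2) @ [Sub r r R_one] @ [Jump_Pos a R_one]"]
      code_at_append[of P "a + 2" "compile c (a + 2)" "[Sub r r R_one] @ [Jump_Pos a R_one]"]
      code_at_append[of P "a + 2 + code_length c" "[Sub r r R_one]" "[Jump_Pos a R_one]"]
    by (simp_all add: numeral_eq_Suc)
  \<comment> \<open>Inner induction on the number of passes still to be made.\<close>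
  have "m R_one = 1 \<Longrightarrow> m r = k \<Longrightarrow> (B ^^ k) E m i o' \<Longrightarrow>
    \<exists>t \<le> k * (poly (time_bound c) N + 3) + 2. \<exists>m' i' o''. Q m' i' o'' \<and>
      run P t \<lparr>pc = a, mem = m, inp = i, out = o'\<rparr> =
        return_pmf \<lparr>pc = ?e, mem = m', inp = i', out = o''\<rparr>" for k m i o'
  proof (induction k arbitrary: m i o')
    case 0
    have "run P (1 + 1) \<lparr>pc = a, mem = m, inp = i, out = o'\<rparr> =
        return_pmf \<lparr>pc = ?e, mem = m, inp = i, out = o'\<rparr>"
      by (rule run_trans[OF run_Jump_Pos[OF code(1)]]) (use 0 run_Jump_Pos[OF code(2)] in \<open>simp del: run.simps One_nat_def\<close>)
    moreover have "Q m i o'" using 0 by (simp add: E_def)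
    ultimately show ?case unfolding one_add_one by (intro exI[of _ 2] conjI exI) auto
  next
    case (Suc k)
    have start: "run P 1 \<lparr>pc = a, mem = m, inp = i, out = o'\<rparr> =
        return_pmf \<lparr>pc = a + 2, mem = m, inp = i, out = o'\<rparr>"
      using run_Jump_Pos[OF code(1)] Suc.prems(2) by (simp del: run.simps One_nat_def)
    have "B ((B ^^ k) E) m i o'" using Suc.prems(3) by simp
    then have "wp N c (loop_post r (m r) ((B ^^ k) E)) m i o'" unfolding B_iff .
    from For.IH[OF this code(3)] obtain t m1 i1 o1 where
      t1: "t \<le> poly (time_bound c) N" and G: "loop_post r (m r) ((B ^^ k) E) m1 i1 o1"
      and body: "run P t \<lparr>pc = a + 2, mem = m, inp = i, out = o'\<rparr> =
        return_pmf \<lparr>pc = a + 2 + code_length c, mem = m1, inp = i1, out = o1\<rparr>"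
      by blast
    from G have t: "m1 r = m r" "m1 R_one = 1" "(B ^^ k) E (m1(r := m r - 1)) i1 o1"
      unfolding loop_post_def by blast+
    let ?M = "m1(r := m r - 1)"
    have again: "run P (1 + 1) \<lparr>pc = a + 2 + code_length c, mem = m1, inp = i1, out = o1\<rparr> =
        return_pmf \<lparr>pc = a, mem = ?M, inp = i1, out = o1\<rparr>" if "r \<noteq> R_one"
    proof (rule run_trans)
      show "run P 1 \<lparr>pc = a + 2 + code_length c, mem = m1, inp = i1, out = o1\<rparr> =
        return_pmf \<lparr>pc = a + 3 + code_length c, mem = ?M, inp = i1, out = o1\<rparr>"
        using run_Sub[OF code(4), of m1 i1 o1] t(1,2) by (simp del: run.simps One_nat_def fun_upd_apply)
      show "run P 1 \<lparr>pc = a + 3 + code_length c, mem = ?M, inp = i1, out = o1\<rparr> =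
        return_pmf \<lparr>pc = a, mem = ?M, inp = i1, out = o1\<rparr>"
        using run_Jump_Pos[OF code(5), of ?M i1 o1] t(2) that by (simp del: run.simps One_nat_def)
    qed
    show ?case
    proof (cases "r = R_one")
      case False
      obtain u m2 i2 o2 where u: "u \<le> k * (poly (time_bound c) N + 3) + 2" "Q m2 i2 o2"
        and rest: "run P u \<lparr>pc = a, mem = ?M, inp = i1, out = o1\<rparr> =
          return_pmf \<lparr>pc = ?e, mem = m2, inp = i2, out = o2\<rparr>"
        using Suc.IH[OF _ _ t(3)] t(1,2) Suc.prems(1,2) False by fastforce
      show ?thesis
        using run_trans[OF run_trans[OF run_trans[OF start body] again[OF False]] rest] t1 u
        by (intro exI[of _ "1 + t + (1 + 1) + u"] conjI exI[of _ m2] exI[of _ i2] exI[of _ o2]) simp_all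
    next
      \<comment> \<open>A loop counting \<open>R_one\<close> itself cannot satisfy
        \<open>wp\<close>: here \<open>k\<close> is 0, and \<open>E\<close> would require the
        register to hold both 0 and 1.\<close>
      case True
      then have "k = 0" using Suc.prems(1,2) by simp
      with t(3) True Suc.prems(2) show ?thesis by (simp add: E_def)
    qed
  qed
  moreover have "m r \<le> N" and "m R_one = 1" "(B ^^ m r) E m i o'"
    using For.prems(1) by (simp_all add: B_def E_def)
  ultimately obtain t m' i' o'' where
    "t \<le> m r * (poly (time_bound c) N + 3) + 2" "Q m' i' o''"
    "run P t \<lparr>pc = a, mem = m, inp = i, out = o'\<rparr> =
        return_pmf \<lparr>pc = ?e, mem = m', inp = i', out = o''\<rparr>" by metis
  moreover from calculation have "t \<le> N * (poly (time_bound c) N + 3) + 2"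
    using mult_le_mono1[OF \<open>m r \<le> N\<close>, of "poly (time_bound c) N + 3"] by linarith
  ultimately show ?case
    by (intro exI[of _ t] conjI exI[of _ m'] exI[of _ i'] exI[of _ o'']) (simp_all add: add.assoc)
qed

section \<open>Halting time and output\<close>

lemma run_halted:
  assumes "halts_within P w t"
  shows "run P (t + u) (initial w) = run P t (initial w)"
proof -
  have "run P u s = return_pmf s" if "halted P s" for s
    using that by (induction u) (auto simp: step_def bind_return_pmf)
  then have "run P (t + u) (initial w) = bind_pmf (run P t (initial w)) return_pmf"
    unfolding run_add using assms by (intro bind_pmf_cong) (auto simp: halts_within_def)
  then show ?thesis by (simp add: bind_return_pmf')
qed

text \<open>The definition takes the least halting time. Any known one serves as well, since halted
  configurations stay put.\<close>

lemma output_distribution_eq: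
  assumes "halts_within P w t"
  shows "output_distribution P w = map_pmf out (run P t (initial w))"
proof -
  let ?t = "LEAST t. halts_within P w t"
  have "halts_within P w ?t" "?t \<le> t"
    using assms by (auto intro: LeastI Least_le)
  then show ?thesis using run_halted[of P w ?t "t - ?t"] by (simp add: output_distribution_def)
qed

text \<open>The code is entered at 0 and ends at its own length, that is, outside the program text,
  which is what halting means. The output is a point mass because no coin is tossed.\<close>

lemma wp_compile:
  assumes "wp N c (\<lambda>m i. Q) (\<lambda>_. 0) w []"
  shows "halts_within (compile c 0) w (poly (time_bound c) N)"
    and "\<exists>xs. Q xs \<and> output_distribution (compile c 0) w = return_pmf xs"
proof -
  let ?P = "compile c 0"
  have "code_at ?P 0 ?P" by (auto simp: code_at_def)
  from wp_run[OF assms this] obtain t m' i' xs where t: "t \<le> poly (time_bound c) N" "Q xs"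
    and r: "run ?P t (initial w) =
      return_pmf \<lparr>pc = code_length c, mem = m', inp = i', out = xs\<rparr>"
    by (auto simp: initial_def)
  then have h: "halts_within ?P w t" by (simp add: halts_within_def halted_def)
  show "halts_within ?P w (poly (time_bound c) N)"
    using run_halted[OF h, of "poly (time_bound c) N - t"] t(1) h by (simp add: halts_within_def)
  show "\<exists>xs. Q xs \<and> output_distribution ?P w = return_pmf xs"
    using output_distribution_eq[OF h] r t(2) by auto
qed

section \<open>Greedy covering\<close>

definition gain :: "fd set \<Rightarrow> nat set \<Rightarrow> nat set \<Rightarrow> nat" where
  "gain F U L = card {i \<in> U. (L, i) \<in> F}"

lemma left_sides_eq: "left_sides F = fst ` F"
  by (force simp: left_sides_def)

lemma tcand_instance_finite:
  assumes "tcand_instance n F T"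
  shows "finite F" "finite T"
  using assms finite_subset[of T "{1..n}"] by (simp_all add: tcand_instance_def)

lemma one_step_closure_mono: "X \<subseteq> Y \<Longrightarrow> one_step_closure n F X \<subseteq> one_step_closure n F Y"
  unfolding one_step_closure_def by blast

text \<open>Left sides that share \<open>x\<close> meet each other, so all of them are counted in
  the term of \<open>Delta\<close> for any one of them.\<close>

lemma degree_le_Delta:
  assumes "finite F"
  shows "card {L \<in> left_sides F. x \<in> L} \<le> Delta F"
proof (cases "\<exists>L \<in> left_sides F. x \<in> L")
  case True
  then obtain L where L: "L \<in> left_sides F" "x \<in> L" by blast
  have fin: "finite (left_sides F)" using assms by (simp add: left_sides_eq)
  have "card {L \<in> left_sides F. x \<in> L} \<le> card {L' \<in> left_sides F. L \<inter> L' \<noteq> {}}"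
    using fin L by (intro card_mono) auto
  also have "\<dots> \<le> Delta F"
    unfolding Delta_def using fin L(1) by (intro Max_ge) auto
  finally show ?thesis .
next
  case False
  then have "{L \<in> left_sides F. x \<in> L} = {}" by blast
  then show ?thesis by (metis card.empty le0)
qed

text \<open>Double counting of the pairs of a left side inside \<open>X\<close> and an element of
  it: each element lies in at most \<open>Delta F\<close> of these left sides.\<close>

lemma sum_card_left_sides_le:
  assumes "finite F" "finite X"
  shows "(\<Sum>L | L \<in> left_sides F \<and> L \<subseteq> X. card L) \<le> Delta F * card X"
proof -
  let ?S = "{L \<in> left_sides F. L \<subseteq> X}"
  have fin: "finite (left_sides F)" using assms by (simp add: left_sides_eq)
  have "(\<Sum>L\<in>?S. card L) = (\<Sum>L\<in>?S. \<Sum>x\<in>X. of_bool (x \<in> L))"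
  proof (intro sum.cong refl)
    fix L assume "L \<in> ?S"
    then have "X \<inter> L = L" by blast
    then show "card L = (\<Sum>x\<in>X. of_bool (x \<in> L))"
      using assms(2) by simp
  qed
  also have "\<dots> = (\<Sum>x\<in>X. card {L \<in> ?S. x \<in> L})"
    using fin by (subst sum.swap) (simp add: Int_def conj_ac)
  also have "\<dots> \<le> (\<Sum>x\<in>X. Delta F)"
  proof (intro sum_mono)
    fix x
    have "card {L \<in> ?S. x \<in> L} \<le> card {L \<in> left_sides F. x \<in> L}"
      using fin by (intro card_mono) auto
    then show "card {L \<in> ?S. x \<in> L} \<le> Delta F"
      using degree_le_Delta[OF assms(1), of x] by linarith
  qed
  finally show ?thesis by (simp add: mult.commute)
qed

text \<open>The optimum \<open>X\<close> covers \<open>U\<close> by the singletons and the left sides inside \<open>X\<close>; every one of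
  them has gain to cost ratio at most \<open>g / k\<close>, and together they cost at most
  \<open>(\<Delta> + 1) |X|\<close>.\<close>

lemma greedy_ratio:
  assumes inst: "tcand_instance n F T" and X: "feasible n F T X" and "U \<subseteq> T" "k \<le> g"
    and ratio: "\<And>L. L \<in> left_sides F \<Longrightarrow> gain F U L * k \<le> g * card L"
  shows "card U * k \<le> g * ((Delta F + 1) * card X)"
proof -
  let ?S = "{L \<in> left_sides F. L \<subseteq> X}"
  have fin: "finite F" "finite T" "finite X"
    using tcand_instance_finite[OF inst] X finite_subset[of X "{1..n}"] by (simp_all add: feasible_def)
  then have finU: "finite U" using \<open>U \<subseteq> T\<close> finite_subset by blast
  have finS: "finite ?S" using fin by (simp add: left_sides_eq)
  have "U \<subseteq> X \<union> (\<Union>L\<in>?S. {i \<in> U. (L, i) \<in> F})"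
  proof
    fix i assume "i \<in> U"
    then have "i \<in> one_step_closure n F X" using X \<open>U \<subseteq> T\<close> by (auto simp: feasible_def)
    then show "i \<in> X \<union> (\<Union>L\<in>?S. {i \<in> U. (L, i) \<in> F})"
      using \<open>i \<in> U\<close> by (auto simp: one_step_closure_def left_sides_def)
  qed
  then have "card U \<le> card (X \<union> (\<Union>L\<in>?S. {i \<in> U. (L, i) \<in> F}))"
    using fin finU finS by (intro card_mono) auto
  also have "\<dots> \<le> card X + card (\<Union>L\<in>?S. {i \<in> U. (L, i) \<in> F})" by (rule card_Un_le)
  also have "\<dots> \<le> card X + (\<Sum>L\<in>?S. gain F U L)"
    unfolding gain_def using card_UN_le[OF finS] by simp
  finally have "card U * k \<le> card X * k + (\<Sum>L\<in>?S. gain F U L * k)"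
    by (metis add_mult_distrib mult_le_mono1 sum_distrib_right)
  \<comment> \<open>The elements of \<open>X\<close> act as singletons with gain and cost 1, for
    which the ratio condition reads \<open>k \<le> g\<close>.\<close>
  also have "\<dots> \<le> card X * g + (\<Sum>L\<in>?S. g * card L)"
    using \<open>k \<le> g\<close> ratio by (intro add_mono sum_mono mult_left_mono) auto
  also have "\<dots> = g * (card X + (\<Sum>L\<in>?S. card L))"
    by (simp add: algebra_simps sum_distrib_left)
  also have "\<dots> \<le> g * (card X + Delta F * card X)"
    using sum_card_left_sides_le[OF fin(1,3)] by (intro mult_left_mono) auto
  finally show ?thesis by (simp add: algebra_simps)
qed

section \<open>The optimum and the cost of the greedy rounds\<close>

lemma OPT_attained:
  assumes "tcand_instance n F T"
  obtains X where "feasible n F T X" "card X = OPT n F T"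
proof -
  let ?A = "card ` {X. feasible n F T X}"
  have "{X. feasible n F T X} \<subseteq> Pow {1..n}" by (auto simp: feasible_def)
  then have "finite ?A" by (metis finite_Pow_iff finite_atLeastAtMost finite_imageI finite_subset)
  moreover have "feasible n F T {1..n}"
    using assms by (auto simp: feasible_def tcand_instance_def one_step_closure_def)
  ultimately have "OPT n F T \<in> ?A" unfolding OPT_def by (intro Min_in) auto
  then show ?thesis using that by auto
qed

text \<open>The difference of harmonic numbers has \<open>g\<close> summands, each the inverse of a
  number at most \<open>u\<close>.\<close>

lemma harm_diff_ge:
  assumes "g \<le> u" "u > 0"
  shows "real g / real u \<le> harm u - harm (u - g)"
  using assms(1)
proof (induction g)
  case (Suc g)
  have "1 / real u \<le> inverse (real (u - g))"
    using Suc.prems by (simp add: field_simps)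
  also have "\<dots> = harm (u - g) - harm (u - Suc g)"
    using Suc.prems harm_Suc[of "u - Suc g", where 'a = real] by (simp add: Suc_diff_Suc)
  finally show ?case using Suc by (simp add: add_divide_distrib)
qed simp

text \<open>\<open>U\<close> is the set of targets still to be covered, \<open>X\<close> the part of the solution chosen so far,
  and \<open>t\<close> the number of rounds left.\<close>

definition greedy_inv :: "nat \<Rightarrow> fd set \<Rightarrow> nat set \<Rightarrow> nat \<Rightarrow> nat set \<Rightarrow> nat set \<Rightarrow> bool" where
  "greedy_inv n F T t U X \<longleftrightarrow> U \<subseteq> T \<and> X \<subseteq> {1..n} \<and> T - U \<subseteq> one_step_closure n F X \<and>
     real (card X) \<le> real ((Delta F + 1) * OPT n F T) * (harm (card T) - harm (card U)) \<and>
     (card U \<le> t \<or> (\<forall>L \<in> left_sides F. gain F U L \<le> card L))"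

text \<open>Every round that buys covers a new target, so \<open>n\<close> rounds suffice. The last
  conjunct of \<open>greedy_inv\<close> records this: either the rounds left can exhaust
  \<open>U\<close>, or no left side gains more than it costs.\<close>

lemma greedy_inv_init:
  assumes "tcand_instance n F T"
  shows "greedy_inv n F T n T {}"
proof -
  have "card T \<le> n" using assms card_mono[of "{1..n}" T] by (auto simp: tcand_instance_def)
  then show ?thesis by (simp add: greedy_inv_def)
qed

text \<open>The price \<open>card L\<close> is spread over the newly covered targets. By
  \<open>greedy_ratio\<close> each pays at most \<open>(Delta F + 1) * OPT n F T / card U\<close>,
  and \<open>harm_diff_ge\<close> bounds the total by a difference of harmonic numbers.\<close>

lemma greedy_inv_choose:
  assumes inst: "tcand_instance n F T" and inv: "greedy_inv n F T (Suc t) U X"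
    and L: "L \<in> left_sides F" "card L < gain F U L"
    and best: "\<And>L'. L' \<in> left_sides F \<Longrightarrow> gain F U L' * card L \<le> gain F U L * card L'"
  shows "greedy_inv n F T t (U - {i. (L, i) \<in> F}) (X \<union> L)"
proof -
  let ?U = "U - {i. (L, i) \<in> F}" and ?g = "gain F U L"
  let ?K = "(Delta F + 1) * OPT n F T"
  \<comment> \<open>A left side with \<open>card L < gain F U L\<close> excludes the second
    alternative of the invariant, which leaves \<open>card U \<le> Suc t\<close>.\<close>
  have U: "U \<subseteq> T" and Xn: "X \<subseteq> {1..n}" and cl: "T - U \<subseteq> one_step_closure n F X"
    and cost: "real (card X) \<le> real ?K * (harm (card T) - harm (card U))"
    and t: "card U \<le> Suc t"
    using inv L by (auto simp: greedy_inv_def)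
  have finU: "finite U" using finite_subset[OF U] tcand_instance_finite[OF inst] by blast
  have Ln: "L \<subseteq> {1..n}" using L(1) inst by (auto simp: left_sides_def tcand_instance_def)
  have *: "?U = U - {i \<in> U. (L, i) \<in> F}" by blast
  have cU: "card ?U = card U - ?g" and gU: "?g \<le> card U"
    unfolding gain_def * using finU by (auto intro!: card_Diff_subset card_mono)
  have Upos: "card U > 0" using gU L(2) by simp
  obtain Y where Y: "feasible n F T Y" "card Y = OPT n F T" using OPT_attained[OF inst] .
  have "card U * card L \<le> ?g * ?K"
    using greedy_ratio[OF inst Y(1) U _ best] L(2) Y(2) by simp
  then have "real (card U) * real (card L) \<le> real ?g * real ?K"
    by (simp only: of_nat_le_iff flip: of_nat_mult)
  then have "real (card L) \<le> real ?K * (real ?g / real (card U))"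
    using Upos by (simp add: field_simps)
  also have "\<dots> \<le> real ?K * (harm (card U) - harm (card ?U))"
    unfolding cU by (intro mult_left_mono harm_diff_ge gU Upos) simp
  finally have "real (card X) + real (card L) \<le> real ?K * (harm (card T) - harm (card ?U))"
    using cost by (simp add: algebra_simps)
  moreover have "card (X \<union> L) \<le> card X + card L" by (rule card_Un_le)
  ultimately have "real (card (X \<union> L)) \<le> real ?K * (harm (card T) - harm (card ?U))"
    by linarith
  moreover have "T - ?U \<subseteq> one_step_closure n F (X \<union> L)"
  proof
    fix i assume i: "i \<in> T - ?U"
    show "i \<in> one_step_closure n F (X \<union> L)"
    proof (cases "i \<in> U")
      case True
      then have "(L, i) \<in> F" using i by blast
      moreover have "i \<in> {1..n}" using i inst by (auto simp: tcand_instance_def)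
      ultimately show ?thesis by (auto simp: one_step_closure_def)
    next
      case False
      then show ?thesis using i cl one_step_closure_mono[of X "X \<union> L" n F] by blast
    qed
  qed
  \<comment> \<open>The gain exceeds \<open>card L\<close>, hence is positive, and \<open>U\<close>
    loses at least one element.\<close>
  moreover have "card ?U \<le> t" using cU t L(2) by simp
  ultimately show ?thesis using U Xn Ln by (auto simp: greedy_inv_def)
qed

lemma greedy_inv_skip:
  assumes "greedy_inv n F T (Suc t) U X" "\<And>L. L \<in> left_sides F \<Longrightarrow> gain F U L \<le> card L"
  shows "greedy_inv n F T t U X"
  using assms by (auto simp: greedy_inv_def)

text \<open>The left sides bought cost at most \<open>1 + ln n\<close> times
  \<open>(Delta F + 1) * OPT n F T\<close>; the targets left over add at most one more such
  multiple.\<close>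

lemma greedy_inv_final:
  assumes inst: "tcand_instance n F T" and inv: "greedy_inv n F T 0 U X" and "n \<ge> 2"
  shows "feasible n F T (X \<union> U)"
    and "real (card (X \<union> U)) \<le> 4 * (real (Delta F) + 1) * ln (real n) * real (OPT n F T)"
proof -
  let ?K = "(Delta F + 1) * OPT n F T"
  have U: "U \<subseteq> T" and cost: "real (card X) \<le> real ?K * (harm (card T) - harm (card U))"
    using inv by (auto simp: greedy_inv_def)
  show "feasible n F T (X \<union> U)"
    unfolding feasible_def
  proof
    show "X \<union> U \<subseteq> {1..n}" using inst inv by (auto simp: greedy_inv_def tcand_instance_def)
    have "T - U \<subseteq> one_step_closure n F (X \<union> U)"
      using inv one_step_closure_mono[of X "X \<union> U" n F] by (auto simp: greedy_inv_def)
    then show "T \<subseteq> one_step_closure n F (X \<union> U)" by (auto simp: one_step_closure_def)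
  qed
  have finU: "finite U" using finite_subset[OF U] tcand_instance_finite[OF inst] by blast
  \<comment> \<open>With no round left, the first alternative of the invariant means that
    \<open>U\<close> is empty, where every gain is 0.\<close>
  have unprofitable: "gain F U L \<le> card L" if "L \<in> left_sides F" for L
  proof -
    have "gain F U L \<le> card U" unfolding gain_def using finU by (auto intro: card_mono)
    then show ?thesis using inv that by (auto simp: greedy_inv_def)
  qed
  obtain Y where Y: "feasible n F T Y" "card Y = OPT n F T" using OPT_attained[OF inst] .
  \<comment> \<open>No ratio exceeds 1 any more, so \<open>greedy_ratio\<close> applies with
    \<open>g\<close> and \<open>k\<close> both 1.\<close>
  have "card U \<le> ?K" using greedy_ratio[OF inst Y(1) U, of 1 1] unprofitable Y(2) by simp
  have "card T \<le> n" using inst card_mono[of "{1..n}" T] by (auto simp: tcand_instance_def)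
  then have "harm (card T) \<le> (harm n :: real)" by (rule harm_mono)
  \<comment> \<open>The sequence \<open>harm n - ln n\<close> decreases and has the value 1 at
    \<open>n = 1\<close>.\<close>
  also have "\<dots> \<le> 1 + ln (real n)"
    using euler_mascheroni_sequence_decreasing[of 1 n] \<open>n \<ge> 2\<close> by (simp add: harm_def)
  finally have h: "harm (card T) - harm (card U) \<le> 1 + ln (real n)"
    using harm_nonneg[of "card U", where 'a = real] by linarith
  have "real (card (X \<union> U)) \<le> real (card X) + real (card U)"
    using card_Un_le[of X U] by linarith
  also have "\<dots> \<le> real ?K * (1 + ln (real n)) + real ?K"
    using cost mult_left_mono[OF h, of "real ?K"] \<open>card U \<le> ?K\<close> by linarith
  also have "\<dots> = real ?K * (2 + ln (real n))" by (simp add: algebra_simps)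
  also have "\<dots> \<le> real ?K * (4 * ln (real n))"
  proof (intro mult_left_mono)
    \<comment> \<open>The constant 4 works because
      \<open>3 * ln n \<ge> 3 * ln 2 \<ge> 2\<close>.\<close>
    have "2 / 3 \<le> ln (2::real)" using ln2_ge_two_thirds .
    also have "\<dots> \<le> ln (real n)" using \<open>n \<ge> 2\<close> by simp
    finally show "2 + ln (real n) \<le> 4 * ln (real n)" by simp
  qed simp
  finally show "real (card (X \<union> U)) \<le> 4 * (real (Delta F) + 1) * ln (real n) * real (OPT n F T)"
    by (simp add: algebra_simps)
qed

declare wp.simps(3) [simp del]

section \<open>Positions in an encoded instance\<close>

lemma nth_concat_map:
  assumes "\<And>x. x \<in> set xs \<Longrightarrow> length (f x) = d" "k < length xs" "j < d"
  shows "concat (map f xs) ! (k * d + j) = f (xs ! k) ! j"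
  using assms
proof (induction xs arbitrary: k)
  case (Cons x xs)
  then show ?case by (cases k) (simp_all add: nth_append)
qed simp

lemma char_vector_nth: "j < n \<Longrightarrow> char_vector n A ! j = of_bool (Suc j \<in> A)"
  by (simp add: char_vector_def del: upt_Suc)

lemma length_char_vector [simp]: "length (char_vector n A) = n"
  by (simp add: char_vector_def)

section \<open>The greedy program\<close>

abbreviation (input) "R_n \<equiv> 3 :: nat"
abbreviation (input) "R_m \<equiv> 4 :: nat"
abbreviation (input) "R_width \<equiv> 5 :: nat"
abbreviation (input) "R_base \<equiv> 6 :: nat"
abbreviation (input) "R_base1 \<equiv> 7 :: nat"
abbreviation (input) "R_rows \<equiv> 8 :: nat"
abbreviation (input) "R_zero \<equiv> 9 :: nat"
abbreviation (input) "R_best_cost \<equiv> 11 :: nat"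
abbreviation (input) "R_best_gain \<equiv> 12 :: nat"
abbreviation (input) "R_found \<equiv> 13 :: nat"
abbreviation (input) "R_best \<equiv> 14 :: nat"
abbreviation (input) "R_row \<equiv> 15 :: nat"
abbreviation (input) "R_k \<equiv> 16 :: nat"
abbreviation (input) "R_cost \<equiv> 17 :: nat"
abbreviation (input) "R_cost_prod \<equiv> 18 :: nat"
abbreviation (input) "R_gain \<equiv> 19 :: nat"
abbreviation (input) "R_gain_prod \<equiv> 20 :: nat"
abbreviation (input) "R_row' \<equiv> 21 :: nat"
abbreviation (input) "R_l \<equiv> 22 :: nat"
abbreviation (input) "R_diff \<equiv> 23 :: nat"
abbreviation (input) "R_p \<equiv> 24 :: nat"
abbreviation (input) "R_q \<equiv> 25 :: nat"
abbreviation (input) "R_j \<equiv> 26 :: nat"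
abbreviation (input) "R_x \<equiv> 27 :: nat"
abbreviation (input) "R_y \<equiv> 28 :: nat"
abbreviation (input) "R_z \<equiv> 29 :: nat"
abbreviation (input) "R_i \<equiv> 30 :: nat"
abbreviation (input) "R_t \<equiv> 31 :: nat"

text \<open>As subtraction is truncated, \<open>x - y\<close> plus \<open>y - x\<close> is the
  absolute difference. So \<open>R_diff\<close> becomes the Hamming distance of two characteristic
  vectors, which is 0 exactly for equal left sides. Incrementing the pointers first skips the right
  sides.\<close>

definition row_diff :: com where
  "row_diff =
     Blk [Const R_diff 0, Add R_p R_row R_zero, Add R_q R_row' R_zero, Add R_j R_n R_zero] ;;
     For R_j (Blk [Add R_p R_p R_one, Add R_q R_q R_one, Load R_x R_p, Load R_y R_q,
       Sub R_z R_x R_y, Add R_diff R_diff R_z, Sub R_z R_y R_x, Add R_diff R_diff R_z])"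

text \<open>The machine cannot multiply. To compare ratios crosswise, the products with the best gain
  and the best cost are accumulated while counting.\<close>

definition row_cost :: com where
  "row_cost =
     Blk [Const R_cost 0, Const R_cost_prod 0, Add R_p R_row R_zero, Add R_j R_n R_zero] ;;
     For R_j (Blk [Add R_p R_p R_one, Load R_x R_p] ;;
       For R_x (Blk [Add R_cost R_cost R_one, Add R_cost_prod R_cost_prod R_best_gain]))"

text \<open>Dependencies with the same left side may be scattered over the list, so all rows are
  scanned. The flag of the right side minus \<open>R_diff\<close> is 1 exactly if that attribute is
  an uncovered target and the left sides agree.\<close>

definition row_gain :: com where
  "row_gain =
     Blk [Const R_gain 0, Const R_gain_prod 0, Add R_row' R_rows R_zero, Add R_l R_m R_zero] ;;
     For R_l (row_diff ;;
       Blk [Load R_x R_row', Add R_x R_x R_base1, Load R_x R_x, Sub R_x R_x R_diff] ;;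
       For R_x (Blk [Add R_gain R_gain R_one, Add R_gain_prod R_gain_prod R_best_cost]) ;;
       Blk [Add R_row' R_row' R_width])"

text \<open>The initial best ratio 1 is that of a singleton.\<close>

definition select_best :: com where
  "select_best =
     Blk [Const R_best_cost 1, Const R_best_gain 1, Const R_found 0,
       Add R_row R_rows R_zero, Add R_k R_m R_zero] ;;
     For R_k (row_cost ;; row_gain ;;
       Blk [Sub R_z R_gain_prod R_cost_prod, Sub R_z R_one R_z, Sub R_z R_one R_z] ;;
       For R_z (Blk [Add R_best_cost R_cost R_zero, Add R_best_gain R_gain R_zero,
         Add R_best R_row R_zero, Const R_found 1]) ;;
       Blk [Add R_row R_row R_width])"

text \<open>\<open>R_p\<close> starts one place before the flags: at the right side of a row, or at
  address 99 for the targets.\<close>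

definition print_marked :: com where
  "print_marked =
     Blk [Const R_i 0, Add R_j R_n R_zero] ;;
     For R_j (Blk [Add R_p R_p R_one, Add R_i R_i R_one, Load R_x R_p] ;; For R_x (Blk [Print R_i]))"

text \<open>One minus \<open>R_diff\<close>, truncated, is the flag for equal left sides.\<close>

definition uncover_row :: com where
  "uncover_row =
     Blk [Add R_row' R_rows R_zero, Add R_l R_m R_zero] ;;
     For R_l (row_diff ;; Blk [Sub R_x R_one R_diff] ;;
       For R_x (Blk [Load R_y R_row', Add R_y R_y R_base1, Store R_y R_zero]) ;;
       Blk [Add R_row' R_row' R_width])"

definition choose_best :: com where
  "choose_best = For R_found
     (Blk [Add R_row R_best R_zero, Add R_p R_best R_zero] ;; print_marked ;; uncover_row)"

text \<open>The number of words after the header is formed in \<open>R_t\<close> by repeated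
  addition; then these words are copied to the addresses from 100 on.\<close>

definition read_input :: com where
  "read_input =
     Blk [Const R_one 1, Const R_zero 0, Read R_n, Read R_m, Add R_width R_n R_one,
       Const R_base 100, Const R_base1 99, Add R_rows R_base R_n,
       Add R_p R_base R_zero, Add R_t R_n R_zero, Add R_k R_m R_zero] ;;
     For R_k (Blk [Add R_t R_t R_width]) ;;
     For R_t (Blk [Read R_x, Store R_p R_x, Add R_p R_p R_one])"

text \<open>A round that finds no profitable left side prints nothing and clears no flag, so exactly
  \<open>n\<close> rounds can be run. The flags still set at the end mark the uncovered
  targets.\<close>

definition greedy :: com where
  "greedy =
     read_input ;;
     Blk [Add R_t R_n R_zero] ;;
     For R_t (select_best ;; choose_best) ;;
     Blk [Add R_p R_base1 R_zero] ;; print_marked"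

section \<open>Frame conditions\<close>

definition same_outside :: "nat set \<Rightarrow> (nat \<Rightarrow> nat) \<Rightarrow> (nat \<Rightarrow> nat) \<Rightarrow> bool" where
  "same_outside S m m' \<longleftrightarrow> (\<forall>r. r \<notin> S \<longrightarrow> m' r = m r)"

lemma same_outside_refl [simp]: "same_outside S m m"
  by (simp add: same_outside_def)

lemma same_outside_upd [simp]:
  "r \<in> S \<Longrightarrow> same_outside S m m' \<Longrightarrow> same_outside S m (m'(r := x))"
  by (auto simp: same_outside_def)

lemma same_outside_trans:
  "same_outside S m m' \<Longrightarrow> same_outside S' m' m'' \<Longrightarrow> S' \<subseteq> S \<Longrightarrow> same_outside S m m''"
  by (auto simp: same_outside_def)

lemma same_outsideD: "same_outside S m m' \<Longrightarrow> r \<notin> S \<Longrightarrow> m' r = m r"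
  by (simp add: same_outside_def)

section \<open>Representation of an instance in memory\<close>

locale greedy_machine =
  fixes n N :: nat and fs :: "fd list"
  assumes fds: "\<And>L i. (L, i) \<in> set fs \<Longrightarrow> L \<subseteq> {1..n} \<and> i \<in> {1..n}"
    and distinct: "distinct fs"
    and n_le: "n \<le> N" and length_le: "length fs \<le> N" and one_le: "1 \<le> N"
begin

definition lhs :: "nat \<Rightarrow> nat set" where "lhs k = fst (fs ! k)"
definition rhs :: "nat \<Rightarrow> nat" where "rhs k = snd (fs ! k)"

text \<open>The flags of the targets start at address 100, and the attributes at 1: attribute \<open>i\<close> has its
  flag at \<open>99 + i\<close>. Row \<open>k\<close> is the right side of a dependency followed by its left side.\<close>

definition row :: "nat \<Rightarrow> nat" where "row k = 100 + n + k * (n + 1)"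

definition regs :: "(nat \<Rightarrow> nat) \<Rightarrow> bool" where
  "regs m \<longleftrightarrow> m R_one = 1 \<and> m R_n = n \<and> m R_m = length fs \<and> m R_width = n + 1 \<and>
     m R_base = 100 \<and> m R_base1 = 99 \<and> m R_rows = 100 + n \<and> m R_zero = 0"

definition holds :: "(nat \<Rightarrow> nat) \<Rightarrow> nat set \<Rightarrow> bool" where
  "holds m U \<longleftrightarrow> regs m \<and>
     (\<forall>j<n. m (100 + j) = of_bool (Suc j \<in> U)) \<and>
     (\<forall>k<length fs. m (row k) = rhs k \<and> (\<forall>j<n. m (row k + Suc j) = of_bool (Suc j \<in> lhs k)))"

lemma row_ge: "100 + n \<le> row k"
  by (simp add: row_def)

lemma row_0: "row 0 = 100 + n"
  by (simp add: row_def)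

lemma row_Suc: "row (Suc k) = row k + (n + 1)"
  by (simp add: row_def)

text \<open>The constants lie below address 10 and the instance from 100 on; everything between is
  working space.\<close>

lemma holds_same:
  assumes "holds m U" "same_outside S m m'" "S \<subseteq> {10..99}"
  shows "holds m' U"
proof -
  have *: "m' r = m r" if "r < 10 \<or> r \<ge> 100" for r
    using assms(2,3) that by (intro same_outsideD) auto
  have "m' (row k) = m (row k)" "m' (Suc (row k + j)) = m (Suc (row k + j))" for k j
    using row_ge[of k] by (simp_all add: *)
  then show ?thesis using assms(1) by (simp add: holds_def regs_def *)
qed

lemma holds_regs:
  assumes "holds m U"
  shows "m R_one = 1" "m R_n = n" "m R_m = length fs" "m R_width = n + 1" "m R_base = 100"
    "m R_base1 = 99" "m R_rows = 100 + n" "m R_zero = 0"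
  using assms by (simp_all add: holds_def regs_def)

lemma holds_target: "holds m U \<Longrightarrow> j < n \<Longrightarrow> m (100 + j) = of_bool (Suc j \<in> U)"
  by (simp add: holds_def)

lemma holds_rhs: "holds m U \<Longrightarrow> k < length fs \<Longrightarrow> m (row k) = rhs k"
  by (simp add: holds_def)

lemma holds_lhs:
  "holds m U \<Longrightarrow> k < length fs \<Longrightarrow> j < n \<Longrightarrow> m (Suc (row k + j)) = of_bool (Suc j \<in> lhs k)"
  by (simp add: holds_def)

lemma lhs_rhs:
  assumes "k < length fs"
  shows "lhs k \<subseteq> {1..n}" "rhs k \<in> {1..n}"
  using fds[of "lhs k" "rhs k"] nth_mem[OF assms] by (simp_all add: lhs_def rhs_def)

lemma holds_rhs_target:
  assumes "holds m U" "k < length fs"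
  shows "m (rhs k + 99) = of_bool (rhs k \<in> U)"
proof -
  obtain j where "rhs k = Suc j" "j < n" using lhs_rhs(2)[OF assms(2)] by (cases "rhs k") auto
  then show ?thesis using holds_target[OF assms(1), of j] by (simp add: add.commute)
qed

lemma lhs_eq_iff:
  assumes "k < length fs" "l < length fs"
  shows "lhs k = lhs l \<longleftrightarrow> (\<forall>j<n. Suc j \<in> lhs k \<longleftrightarrow> Suc j \<in> lhs l)"
proof -
  have "A \<subseteq> B" if "A \<subseteq> {1..n}" "\<forall>j<n. Suc j \<in> A \<longrightarrow> Suc j \<in> B" for A B
  proof
    fix x assume "x \<in> A"
    then have "x \<in> {1..n}" using that(1) by blast
    then obtain j where "x = Suc j" "j < n" by (cases x) auto
    then show "x \<in> B" using that(2) \<open>x \<in> A\<close> by simp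
  qed
  from this[of "lhs k" "lhs l"] this[of "lhs l" "lhs k"] show ?thesis
    using lhs_rhs(1)[OF assms(1)] lhs_rhs(1)[OF assms(2)] by auto
qed

section \<open>Correctness of the subroutines\<close>

lemma wp_row_diff:
  assumes h: "holds m U" and kl: "k < length fs" "l < length fs"
    and rows: "m R_row = row k" "m R_row' = row l"
    and Q: "\<And>m'. same_outside {23..29} m m' \<Longrightarrow> (m' R_diff = 0 \<longleftrightarrow> lhs k = lhs l) \<Longrightarrow> Q m' i o'"
  shows "wp N row_diff Q m i o'"
  unfolding row_diff_def wp.simps(1,2) wp_block.simps wp_instr.simps
proof (rule wp_For[where T = n and I = "\<lambda>t m' i' o''. same_outside {23..29} m m' \<and>
    m' R_p = row k + t \<and> m' R_q = row l + t \<and>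
    (m' R_diff = 0 \<longleftrightarrow> (\<forall>j<t. Suc j \<in> lhs k \<longleftrightarrow> Suc j \<in> lhs l)) \<and> i' = i \<and> o'' = o'"], goal_cases)
  case (5 t m1 i1 o1)
  then have h1: "holds m1 U" using holds_same[OF h, of "{23..29}" m1] by simp
  note [simp] = holds_regs[OF h1] holds_lhs[OF h1 kl(1) 5(1)] holds_lhs[OF h1 kl(2) 5(1)]
  from 5 row_ge[of k] row_ge[of l] show ?case
    by (simp add: less_Suc_eq all_conj_distrib) (auto simp: of_bool_def)
next
  case (6 m1 i1 o1)
  then show ?case using Q lhs_eq_iff[OF kl] by simp
qed (use holds_regs[OF h] rows n_le in simp_all)

lemma wp_row_cost:
  assumes h: "holds m U" and k: "k < length fs" and row: "m R_row = row k"
    and Q: "\<And>m'. same_outside {17..29} m m' \<Longrightarrow> m' R_cost = card (lhs k) \<Longrightarrow>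
      m' R_cost_prod = card (lhs k) * m R_best_gain \<Longrightarrow> Q m' i o'"
  shows "wp N row_cost Q m i o'"
  unfolding row_cost_def wp.simps(1,2) wp_block.simps wp_instr.simps
proof (rule wp_For[where T = n and I = "\<lambda>t m' i' o''. same_outside {17..29} m m' \<and>
    m' R_p = row k + t \<and> m' R_cost = card (lhs k \<inter> {1..t}) \<and>
    m' R_cost_prod = card (lhs k \<inter> {1..t}) * m R_best_gain \<and> i' = i \<and> o'' = o'"], goal_cases)
  case (5 t m1 i1 o1)
  then have h1: "holds m1 U" using holds_same[OF h, of "{17..29}" m1] by simp
  have g: "m1 R_best_gain = m R_best_gain" using 5 same_outsideD[of "{17..29}" m m1] by simp
  note [simp] = holds_regs[OF h1] holds_lhs[OF h1 k 5(1)]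
  have "{1..Suc t} = insert (Suc t) {1..t}" by auto
  then have c: "card (lhs k \<inter> {1..Suc t}) = card (lhs k \<inter> {1..t}) + of_bool (Suc t \<in> lhs k)"
    by simp
  note * = 5 row_ge[of k] g one_le c
  show ?case unfolding wp.simps(1,2) wp_block.simps wp_instr.simps
  proof (rule wp_If, goal_cases)
    case 5
    then show ?case using * by simp
  next
    case 6
    then show ?case using * by simp
  qed (use * in simp_all)
next
  case (6 m1 i1 o1)
  have "lhs k \<inter> {1..n} = lhs k" using lhs_rhs(1)[OF k] by blast
  then show ?case using Q 6 by simp
qed (use holds_regs[OF h] row n_le in simp_all)

text \<open>Counts rows instead of attributes, so that each pass of the scan adds at most
  one.\<close>

definition matches :: "nat set \<Rightarrow> nat set \<Rightarrow> nat \<Rightarrow> nat" where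
  "matches U L t = card {l. l < t \<and> lhs l = L \<and> rhs l \<in> U}"

lemma matches_0 [simp]: "matches U L 0 = 0"
  by (simp add: matches_def)

lemma matches_Suc: "matches U L (Suc t) = matches U L t + of_bool (lhs t = L \<and> rhs t \<in> U)"
proof -
  let ?A = "{l. l < t \<and> lhs l = L \<and> rhs l \<in> U}"
  have "{l. l < Suc t \<and> lhs l = L \<and> rhs l \<in> U} = (if lhs t = L \<and> rhs t \<in> U then insert t ?A else ?A)"
    by (auto simp: less_Suc_eq)
  then show ?thesis by (simp add: matches_def)
qed

lemma fs_nth: "fs ! l = (lhs l, rhs l)"
  by (simp add: lhs_def rhs_def)

text \<open>The list is distinct, so rows with the same left side have different right sides, and
  counting rows counts attributes.\<close>

lemma gain_eq_matches: "gain (set fs) U L = matches U L (length fs)"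
proof -
  let ?A = "{l. l < length fs \<and> lhs l = L \<and> rhs l \<in> U}"
  have "{i \<in> U. (L, i) \<in> set fs} = rhs ` ?A"
    by (auto simp: in_set_conv_nth fs_nth)
  moreover have "inj_on rhs ?A"
    using distinct fs_nth by (auto simp: inj_on_def) (metis nth_eq_iff_index_eq)
  ultimately show ?thesis by (simp add: gain_def matches_def card_image)
qed

lemma wp_row_gain:
  assumes h: "holds m U" and k: "k < length fs" and row: "m R_row = row k"
    and Q: "\<And>m'. same_outside {19..29} m m' \<Longrightarrow> m' R_gain = gain (set fs) U (lhs k) \<Longrightarrow>
      m' R_gain_prod = gain (set fs) U (lhs k) * m R_best_cost \<Longrightarrow> Q m' i o'"
  shows "wp N row_gain Q m i o'"
  unfolding row_gain_def wp.simps(1,2) wp_block.simps wp_instr.simps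
proof (rule wp_For[where T = "length fs" and I = "\<lambda>t m' i' o''. same_outside {19..29} m m' \<and>
    m' R_row' = row t \<and> m' R_gain = matches U (lhs k) t \<and>
    m' R_gain_prod = matches U (lhs k) t * m R_best_cost \<and> i' = i \<and> o'' = o'"], goal_cases)
  case (5 t m1 i1 o1)
  then have s1: "same_outside {19..29} m m1" by simp
  then have h1: "holds m1 U" using holds_same[OF h, of "{19..29}" m1] by simp
  have r1: "m1 R_row = row k" "m1 R_row' = row t" "m1 R_best_cost = m R_best_cost"
    using 5 row same_outsideD[OF s1] by simp_all
  show ?case unfolding wp.simps(1,2)
  proof (rule wp_row_diff[OF h1 k 5(1) r1(1,2)], goal_cases)
    case (1 m2)
    note s2 = 1(1) and d = 1(2)
    have h2: "holds m2 U" using holds_same[OF h1 s2] by simp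
    have s: "same_outside {19..29} m m2" using same_outside_trans[OF s1 s2] by simp
    have r2: "m2 R_row' = row t" "m2 R_best_cost = m R_best_cost" "m2 R_l = length fs - t"
      "m2 R_gain = matches U (lhs k) t" "m2 R_gain_prod = matches U (lhs k) t * m R_best_cost"
      using 5 r1 same_outsideD[OF s2] by simp_all
    have io: "i1 = i" "o1 = o'" using 5 by simp_all
    note [simp] = holds_regs[OF h2] holds_rhs[OF h2 5(1)] holds_rhs_target[OF h2 5(1)] r2 matches_Suc
      row_Suc
    show ?case
      unfolding wp_block.simps wp_instr.simps
    proof (rule wp_If, goal_cases)
      case 5
      then show ?case using s d io by (auto simp: of_bool_def split: if_splits)
    next
      case 6
      then show ?case using s d io by (auto simp: of_bool_def split: if_splits)
    qed (use one_le in simp_all)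
  qed
next
  case (6 m1 i1 o1)
  then show ?case using Q by (simp add: gain_eq_matches)
qed (use holds_regs[OF h] row_0 length_le in simp_all)

text \<open>Ratios are compared by cross multiplication, so an empty left side, of cost 0, needs no
  special case. While nothing is found, the comparison is with the ratio 1.\<close>

definition best_upto :: "nat set \<Rightarrow> nat \<Rightarrow> nat \<Rightarrow> nat \<Rightarrow> nat \<Rightarrow> nat \<Rightarrow> bool" where
  "best_upto U k found r c g \<longleftrightarrow>
     found = 0 \<and> c = 1 \<and> g = 1 \<and> (\<forall>l<k. gain (set fs) U (lhs l) \<le> card (lhs l)) \<or>
     found = 1 \<and> (\<exists>b<k. r = row b \<and> c = card (lhs b) \<and> g = gain (set fs) U (lhs b) \<and> c < g \<and>
       (\<forall>l<k. gain (set fs) U (lhs l) * c \<le> g * card (lhs l)))"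

lemma best_upto_keep:
  assumes "best_upto U k found r c g" "gain (set fs) U (lhs k) * c \<le> g * card (lhs k)"
  shows "best_upto U (Suc k) found r c g"
  using assms unfolding best_upto_def by (auto simp: less_Suc_eq)

text \<open>Transitivity of the comparison of ratios, with the factor \<open>c\<close> cancelled. It
  is positive, as an empty best left side is never beaten. From \<open>c \<le> g\<close> the new
  ratio is again above 1.\<close>

lemma best_upto_replace:
  assumes b: "best_upto U k found r c g" and less: "g * card (lhs k) < gain (set fs) U (lhs k) * c"
  shows "best_upto U (Suc k) 1 (row k) (card (lhs k)) (gain (set fs) U (lhs k))"
proof -
  let ?c = "card (lhs k)" and ?g = "gain (set fs) U (lhs k)"
  have "c > 0" using less by (cases c) auto
  have "c \<le> g" and ratio: "\<And>l. l < k \<Longrightarrow> gain (set fs) U (lhs l) * c \<le> g * card (lhs l)"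
    using b by (auto simp: best_upto_def)
  have "?c * c \<le> g * ?c" using \<open>c \<le> g\<close> by (simp add: mult.commute)
  also note less
  finally have "?c < ?g" by simp
  moreover have "gain (set fs) U (lhs l) * ?c \<le> ?g * card (lhs l)" if "l < k" for l
  proof -
    have "c * (gain (set fs) U (lhs l) * ?c) \<le> g * card (lhs l) * ?c"
      using mult_le_mono1[OF ratio[OF that], of ?c] by (simp add: ac_simps)
    also have "\<dots> \<le> c * (?g * card (lhs l))"
      using mult_le_mono1[OF less_imp_le[OF less], of "card (lhs l)"] by (simp add: ac_simps)
    finally show ?thesis using \<open>c > 0\<close> by simp
  qed
  ultimately show ?thesis by (auto simp: best_upto_def less_Suc_eq)
qed

text \<open>Subtracting twice from 1 turns the truncated difference of \<open>R_gain_prod\<close>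
  and \<open>R_cost_prod\<close> into a flag, so the record changes only on a strict
  improvement.\<close>

lemma wp_select_best:
  assumes h: "holds m U"
    and Q: "\<And>m'. same_outside {11..29} m m' \<Longrightarrow>
      best_upto U (length fs) (m' R_found) (m' R_best) (m' R_best_cost) (m' R_best_gain) \<Longrightarrow> Q m' i o'"
  shows "wp N select_best Q m i o'"
  unfolding select_best_def wp.simps(1,2) wp_block.simps wp_instr.simps
proof (rule wp_For[where T = "length fs" and I = "\<lambda>k m' i' o''. same_outside {11..29} m m' \<and>
    m' R_row = row k \<and> best_upto U k (m' R_found) (m' R_best) (m' R_best_cost) (m' R_best_gain) \<and>
    i' = i \<and> o'' = o'"], goal_cases)
  case (5 k m1 i1 o1)
  then have s1: "same_outside {11..29} m m1" by simp
  then have h1: "holds m1 U" using holds_same[OF h, of "{11..29}" m1] by simp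
  have r1: "m1 R_row = row k" "m1 R_k = length fs - k" using 5 by simp_all
  let ?c = "card (lhs k)" and ?g = "gain (set fs) U (lhs k)"
  show ?case unfolding wp.simps(1,2)
  proof (rule wp_row_cost[OF h1 5(1) r1(1)], goal_cases)
    case (1 m2)
    note s2 = 1(1) and c = 1(2,3)
    have h2: "holds m2 U" using holds_same[OF h1 s2] by simp
    have r2: "m2 R_row = row k" using r1 same_outsideD[OF s2] by simp
    show ?case
    proof (rule wp_row_gain[OF h2 5(1) r2], goal_cases)
      case (1 m3)
      note s3 = 1(1) and g = 1(2,3)
      have h3: "holds m3 U" using holds_same[OF h2 s3] by simp
      have s: "same_outside {11..29} m m3"
        using same_outside_trans[OF same_outside_trans[OF s1 s2] s3] by simp
      have r3: "m3 R_row = row k" "m3 R_k = length fs - k" "m3 R_cost = ?c"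
        "m3 R_cost_prod = ?c * m1 R_best_gain" "m3 R_gain_prod = ?g * m1 R_best_cost"
        "m3 R_found = m1 R_found" "m3 R_best = m1 R_best" "m3 R_best_cost = m1 R_best_cost"
        "m3 R_best_gain = m1 R_best_gain"
        using r1 c g same_outsideD[OF s2] same_outsideD[OF s3] by simp_all
      have b: "best_upto U k (m1 R_found) (m1 R_best) (m1 R_best_cost) (m1 R_best_gain)" "i1 = i" "o1 = o'"
        using 5 by simp_all
      note [simp] = holds_regs[OF h3] r3 g(1) row_Suc b(2,3)
      show ?case
        unfolding wp_block.simps wp_instr.simps
      proof (rule wp_If, goal_cases)
        case 5
        then have less: "m1 R_best_gain * ?c < ?g * m1 R_best_cost" by (simp add: mult.commute)
        show ?case using best_upto_replace[OF b(1) less] s 5 by simp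
      next
        case 6
        then have "?g * m1 R_best_cost \<le> m1 R_best_gain * ?c" by (simp add: mult.commute)
        from best_upto_keep[OF b(1) this] show ?case using s by simp
      qed (use one_le in simp_all)
    qed
  qed
next
  case (6 m1 i1 o1)
  then show ?case using Q by simp
qed (use holds_regs[OF h] row_0 length_le in \<open>simp_all add: best_upto_def\<close>)

text \<open>The output is described as a set, because attributes may be printed repeatedly.\<close>

lemma wp_print_marked:
  assumes h: "holds m U" and a: "m R_p = a" "a \<ge> 99" and A: "A \<subseteq> {1..n}"
    and marked: "\<And>j. j < n \<Longrightarrow> m (a + Suc j) = of_bool (Suc j \<in> A)"
    and Q: "\<And>m' o''. same_outside {24..30} m m' \<Longrightarrow> set o'' = set o' \<union> A \<Longrightarrow> Q m' i o''"
  shows "wp N print_marked Q m i o'"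
  unfolding print_marked_def wp.simps(1,2) wp_block.simps wp_instr.simps
proof (rule wp_For[where T = n and I = "\<lambda>t m' i' o''. same_outside {24..30} m m' \<and>
    m' R_p = a + t \<and> m' R_i = t \<and> set o'' = set o' \<union> (A \<inter> {1..t}) \<and> i' = i"], goal_cases)
  case (5 t m1 i1 o1)
  then have s1: "same_outside {24..30} m m1" by simp
  then have h1: "holds m1 U" using holds_same[OF h, of "{24..30}" m1] by simp
  \<comment> \<open>By \<open>a \<ge> 99\<close> the flag lies at 100 or above, out of reach of the
    working registers.\<close>
  have x: "m1 (Suc (a + t)) = of_bool (Suc t \<in> A)"
    using same_outsideD[OF s1, of "Suc (a + t)"] marked[OF 5(1)] a(2) by simp
  have "{1..Suc t} = insert (Suc t) {1..t}" by auto
  then have A_Suc: "A \<inter> {1..Suc t} = (if Suc t \<in> A then insert (Suc t) (A \<inter> {1..t}) else A \<inter> {1..t})"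
    by simp
  note [simp] = holds_regs[OF h1] x
  note * = 5 a(2) A_Suc one_le
  show ?case unfolding wp.simps(1,2) wp_block.simps wp_instr.simps
    by (rule wp_If) (use * in \<open>simp_all split: if_splits\<close>)
next
  case (6 m1 i1 o1)
  have "A \<inter> {1..n} = A" using A by blast
  then show ?case using Q 6 by simp
qed (use holds_regs[OF h] a n_le in simp_all)

text \<open>The rows begin after the \<open>n\<close> target flags, so clearing one flag damages no
  dependency.\<close>

lemma holds_uncover:
  assumes "holds m U" "x \<in> {1..n}" "m' (x + 99) = 0"
    and same: "\<And>r. r \<noteq> x + 99 \<Longrightarrow> r \<notin> {10..99} \<Longrightarrow> m' r = m r"
  shows "holds m' (U - {x})"
proof -
  obtain y where y: "x = Suc y" "y < n" using assms(2) by (cases x) auto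
  have "row k \<noteq> 100 + y" "Suc (row k + j) \<noteq> 100 + y" for k j
    using row_ge[of k] y(2) by linarith+
  then have "holds (m(x + 99 := 0)) (U - {x})"
    using assms(1) y by (simp add: holds_def regs_def add.commute)
  moreover have "same_outside {10..99} (m(x + 99 := 0)) m'"
    using same assms(3) by (simp add: same_outside_def)
  ultimately show ?thesis by (rule holds_same) simp
qed

text \<open>The flags change, so the frame includes the addresses from 100 on; that the dependencies
  survive is part of \<open>holds\<close>.\<close>

lemma wp_uncover_row:
  assumes h: "holds m U" and k: "k < length fs" and row: "m R_row = row k"
    and Q: "\<And>m'. same_outside ({21..29} \<union> {100..}) m m' \<Longrightarrow>
      holds m' (U - {i. (lhs k, i) \<in> set fs}) \<Longrightarrow> Q m' i o'"
  shows "wp N uncover_row Q m i o'"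
  unfolding uncover_row_def wp.simps(1,2) wp_block.simps wp_instr.simps
proof (rule wp_For[where T = "length fs" and I = "\<lambda>t m' i' o''.
    same_outside ({21..29} \<union> {100..}) m m' \<and>
    holds m' (U - {rhs l | l. l < t \<and> lhs l = lhs k}) \<and> m' R_row' = row t \<and> i' = i \<and> o'' = o'"],
    goal_cases)
  case 4
  have "same_outside {21..29} m (m(R_row' := m R_rows + m R_zero, R_l := m R_m + m R_zero))" by simp
  from holds_same[OF h this] show ?case using holds_regs[OF h] row_0 by simp
next
  case (5 t m1 i1 o1)
  let ?U = "\<lambda>t. U - {rhs l | l. l < t \<and> lhs l = lhs k}"
  note t = 5(1)
  have s1: "same_outside ({21..29} \<union> {100..}) m m1" and h1: "holds m1 (?U t)"
    and r1: "m1 R_row' = row t" "m1 R_l = length fs - t" and io: "i1 = i" "o1 = o'"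
    using 5 by simp_all
  have r1': "m1 R_row = row k" using row same_outsideD[OF s1] by simp
  show ?case unfolding wp.simps(1,2)
  proof (rule wp_row_diff[OF h1 k 5(1) r1' r1(1)], goal_cases)
    case (1 m2)
    note s2 = 1(1) and d = 1(2)
    have h2: "holds m2 (?U t)" using holds_same[OF h1 s2] by simp
    have s: "same_outside ({21..29} \<union> {100..}) m m2"
      using same_outside_trans[OF s1 s2] by (simp add: le_supI1)
    have r2: "m2 R_row' = row t" "m2 R_l = length fs - t" using r1 same_outsideD[OF s2] by simp_all
    have U_Suc: "?U (Suc t) = (if lhs t = lhs k then ?U t - {rhs t} else ?U t)"
      by (auto simp: less_Suc_eq)
    show ?case unfolding wp_block.simps wp_instr.simps
    proof (rule wp_If, goal_cases)
      case 5
      then have eq: "lhs t = lhs k" using d holds_regs[OF h2] by (auto split: if_splits)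
      then have d0: "m2 R_diff = 0" "row t \<noteq> R_x" using d row_ge[of t] by simp_all
      have r: "rhs t \<in> {1..n}" using lhs_rhs(2)[OF t] .
      then show ?case unfolding wp.simps(1,2) wp_block.simps wp_instr.simps U_Suc if_P[OF eq]
        by (simp add: holds_regs[OF h2] holds_rhs[OF h2 t] r2 io row_Suc s d0)
          (rule holds_uncover[OF h2 r]; auto)
    next
      case 6
      then have neq: "lhs t \<noteq> lhs k" using d holds_regs[OF h2] by auto
      show ?case unfolding wp.simps(1,2) wp_block.simps wp_instr.simps U_Suc if_not_P[OF neq]
        by (simp add: holds_regs[OF h2] holds_rhs[OF h2 t] r2 io row_Suc s)
          (rule holds_same[OF h2, of "{21..29}"]; simp)
    qed (use one_le holds_regs[OF h2] in simp_all)
  qed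
next
  case (6 m1 i1 o1)
  have "{rhs l | l. l < length fs \<and> lhs l = lhs k} = {i. (lhs k, i) \<in> set fs}"
    by (auto simp: in_set_conv_nth fs_nth)
  then show ?case using Q 6 by simp
qed (use holds_regs[OF h] length_le in simp_all)

lemma lhs_left_sides: "k < length fs \<Longrightarrow> lhs k \<in> left_sides (set fs)"
  using nth_mem by (force simp: left_sides_eq lhs_def)

lemma left_sides_lhs: "L \<in> left_sides (set fs) \<Longrightarrow> \<exists>k < length fs. lhs k = L"
  by (force simp: left_sides_eq lhs_def in_set_conv_nth)

text \<open>One greedy round, with the output list in the role of the partial solution: printing
  \<open>lhs b\<close> is buying it.\<close>

lemma wp_choose_best:
  assumes inst: "tcand_instance n (set fs) T" and h: "holds m U"
    and best: "best_upto U (length fs) (m R_found) (m R_best) (m R_best_cost) (m R_best_gain)"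
    and inv: "greedy_inv n (set fs) T (Suc t) U (set o')"
    and Q: "\<And>m' U' o''. holds m' U' \<Longrightarrow> m' R_t = m R_t \<Longrightarrow>
      greedy_inv n (set fs) T t U' (set o'') \<Longrightarrow> Q m' i o''"
  shows "wp N choose_best Q m i o'"
  unfolding choose_best_def
proof (rule wp_If, goal_cases)
  case 5
  then obtain b where b: "b < length fs" "m R_best = row b" "m R_best_cost = card (lhs b)"
    "m R_best_gain = gain (set fs) U (lhs b)" "card (lhs b) < gain (set fs) U (lhs b)"
    and ratio: "\<And>l. l < length fs \<Longrightarrow>
      gain (set fs) U (lhs l) * card (lhs b) \<le> gain (set fs) U (lhs b) * card (lhs l)"
    using best by (auto simp: best_upto_def)
  have ratio': "gain (set fs) U L * card (lhs b) \<le> gain (set fs) U (lhs b) * card L"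
    if "L \<in> left_sides (set fs)" for L
    using left_sides_lhs[OF that] ratio by auto
  let ?m = "m(R_row := m R_best + m R_zero, R_p := (m(R_row := m R_best + m R_zero)) R_best +
    (m(R_row := m R_best + m R_zero)) R_zero)"
  have s0: "same_outside {15..30} m ?m" by simp
  have h0: "holds ?m U" using holds_same[OF h s0] by simp
  have r0: "?m R_row = row b" "?m R_p = row b" using b holds_regs[OF h] by simp_all
  show ?case unfolding wp.simps(1,2) wp_block.simps wp_instr.simps
  proof (rule wp_print_marked[OF h0 r0(2) _ lhs_rhs(1)[OF b(1)]], goal_cases)
    case 1
    then show ?case using row_ge[of b] by simp
  next
    case (2 j)
    show ?case using holds_lhs[OF h0 b(1) 2] by (simp del: fun_upd_apply)
  next
    case (3 m1 o1)
    note s1 = 3(1) and o1 = 3(2)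
    have h1: "holds m1 U" using holds_same[OF h0 s1] by simp
    have r1: "m1 R_row = row b" using same_outsideD[OF s1] r0 by simp
    show ?case
    proof (rule wp_uncover_row[OF h1 b(1) r1], goal_cases)
      case (1 m2)
      have "m2 R_found = 1" "m2 R_t = m R_t"
        using \<open>m R_found = 1\<close> same_outsideD[OF 1(1)] same_outsideD[OF s1] same_outsideD[OF s0]
        by simp_all
      moreover have "same_outside {10..99} m2 (m2(R_found := 0))" by simp
      from holds_same[OF 1(2) this]
      have "holds (m2(R_found := 0)) (U - {i. (lhs b, i) \<in> set fs})" by simp
      moreover have "greedy_inv n (set fs) T t (U - {i. (lhs b, i) \<in> set fs}) (set o1)"
        using greedy_inv_choose[OF inst inv lhs_left_sides[OF b(1)] b(5) ratio'] o1 by simp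
      ultimately show ?case using Q holds_regs[OF 1(2)] by simp
    qed
  qed
next
  case 6
  then have "gain (set fs) U L \<le> card L" if "L \<in> left_sides (set fs)" for L
    using left_sides_lhs[OF that] best by (auto simp: best_upto_def)
  then show ?case using Q h greedy_inv_skip[OF inv] by simp
qed (use best one_le holds_regs[OF h] in \<open>auto simp: best_upto_def\<close>)

section \<open>The greedy rounds together\<close>

lemma wp_main:
  assumes inst: "tcand_instance n (set fs) T" and h: "holds m T"
    and Q: "\<And>m' U X o''. greedy_inv n (set fs) T 0 U X \<Longrightarrow> set o'' = X \<union> U \<Longrightarrow> Q m' i o''"
  shows "wp N (Blk [Add R_t R_n R_zero] ;; For R_t (select_best ;; choose_best) ;;
    Blk [Add R_p R_base1 R_zero] ;; print_marked) Q m i []"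
  unfolding wp.simps(1,2) wp_block.simps wp_instr.simps
proof (rule wp_For[where T = n and I = "\<lambda>t m' i' o''. i' = i \<and>
    (\<exists>U. holds m' U \<and> greedy_inv n (set fs) T (n - t) U (set o''))"], goal_cases)
  case 4
  have "same_outside {10..99} m (m(R_t := m R_n + m R_zero))" by simp
  from holds_same[OF h this] have "holds (m(R_t := m R_n + m R_zero)) T" by simp
  then show ?case using greedy_inv_init[OF inst] by auto
next
  case (5 t m1 i1 o1)
  then obtain U where h1: "holds m1 U" and inv: "greedy_inv n (set fs) T (n - t) U (set o1)"
    and io: "i1 = i" by auto
  from inv have inv': "greedy_inv n (set fs) T (Suc (n - Suc t)) U (set o1)"
    using 5(1) by (simp add: Suc_diff_Suc)
  show ?case unfolding wp.simps(1,2)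
  proof (rule wp_select_best[OF h1], goal_cases)
    case (1 m2)
    note s2 = 1(1) and best = 1(2)
    have h2: "holds m2 U" using holds_same[OF h1 s2] by simp
    have t: "m2 R_t = n - t" using same_outsideD[OF s2] 5(3) by simp
    show ?case
    proof (rule wp_choose_best[OF inst h2 best inv'], goal_cases)
      case (1 m3 U' o3)
      have "same_outside {10..99} m3 (m3(R_t := n - Suc t))" by simp
      from holds_same[OF 1(1) this] have "holds (m3(R_t := n - Suc t)) U'" by simp
      then show ?case using 1 t io holds_regs[OF 1(1)] by auto
    qed
  qed
next
  case (6 m1 i1 o1)
  then obtain U where h1: "holds m1 U" and inv: "greedy_inv n (set fs) T 0 U (set o1)"
    and io: "i1 = i" by auto
  have "same_outside {10..99} m1 (m1(R_p := m1 R_base1 + m1 R_zero))" by simp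
  from holds_same[OF h1 this] have h2: "holds (m1(R_p := m1 R_base1 + m1 R_zero)) U" by simp
  have U: "U \<subseteq> {1..n}" using inv inst by (auto simp: greedy_inv_def tcand_instance_def)
  show ?case
  proof (rule wp_print_marked[OF h2 _ _ U, of 99], goal_cases)
    case 1
    then show ?case using holds_regs[OF h1] by simp
  next
    case (3 j)
    then show ?case using holds_target[OF h2, of j] by simp
  next
    case (4 m2 o2)
    then show ?case using Q[OF inv] io by simp
  qed simp
qed (use holds_regs[OF h] n_le in simp_all)

section \<open>Reading the input\<close>

lemma encode_target: "j < n \<Longrightarrow> encode n fs T ! Suc (Suc j) = of_bool (Suc j \<in> T)"
  by (simp add: encode_def nth_append char_vector_nth)

text \<open>Two header words and \<open>n\<close> target flags precede the rows, each of which has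
  \<open>n + 1\<close> words.\<close>

lemma encode_row:
  assumes "k < length fs" "j \<le> n"
  shows "encode n fs T ! (Suc (Suc (n + k * (n + 1) + j))) = (rhs k # char_vector n (lhs k)) ! j"
proof -
  let ?f = "\<lambda>(L, i). i # char_vector n L"
  have "concat (map ?f fs) ! (k * (n + 1) + j) = ?f (fs ! k) ! j"
    by (rule nth_concat_map) (use assms in \<open>auto simp: less_Suc_eq_le\<close>)
  then show ?thesis
    by (simp add: encode_def nth_append lhs_def rhs_def case_prod_unfold add.assoc)
qed

lemma wp_read_input:
  assumes N: "n + length fs * (n + 1) \<le> N"
    and Q: "\<And>m i. holds m T \<Longrightarrow> Q m i o'"
  shows "wp N read_input Q (\<lambda>_. 0) (encode n fs T) o'"
  unfolding read_input_def wp.simps(1,2) wp_block.simps wp_instr.simps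
\<comment> \<open>This loop computes the number of words to copy.\<close>
proof (rule wp_For[where T = "length fs" and I = "\<lambda>k m i o''. regs m \<and> m R_p = 100 \<and>
    m R_t = n + k * (n + 1) \<and> i = drop 2 (encode n fs T) \<and> o'' = o'"], goal_cases)
  case 4
  show ?case by (simp add: regs_def encode_def)
next
  case (5 k m1 i1 o1)
  then show ?case by (simp add: regs_def)
next
  case (6 m1 i1 o1)
  let ?w = "encode n fs T" and ?s = "n + length fs * (n + 1)"
  have len: "length ?w = 2 + ?s" by (simp add: length_encode)
  show ?case
  \<comment> \<open>This loop moves the word at index \<open>2 + j\<close> of the input to address
    \<open>100 + j\<close>.\<close>
  proof (rule wp_For[where T = ?s and I = "\<lambda>t m i o''. regs m \<and> m R_p = 100 + t \<and>
      (\<forall>j<t. m (100 + j) = ?w ! Suc (Suc j)) \<and> i = drop (2 + t) ?w \<and> o'' = o'"], goal_cases)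
    case (5 t m2 i2 o2)
    have "drop (2 + t) ?w = ?w ! Suc (Suc t) # drop (2 + Suc t) ?w"
      using 5(1) len Cons_nth_drop_Suc[of "2 + t" ?w] by simp
    then show ?case using 5 by (simp add: regs_def less_Suc_eq)
  next
    case (6 m2 i2 o2)
    have m2: "m2 (100 + j) = ?w ! Suc (Suc j)" if "j < ?s" for j using 6 that by simp
    have lt: "n + k * (n + 1) + j < ?s" if "k < length fs" "j \<le> n" for k j
    proof -
      have "Suc k * (n + 1) \<le> length fs * (n + 1)" using that(1) by (intro mult_le_mono1) simp
      then show ?thesis using that(2) by simp
    qed
    have r: "m2 (row k + j) = (rhs k # char_vector n (lhs k)) ! j" if "k < length fs" "j \<le> n" for k j
      using m2[OF lt[OF that]] encode_row[OF that] by (simp add: row_def add.assoc)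
    have "holds m2 T"
      unfolding holds_def
    proof (intro conjI allI impI)
      show "regs m2" using 6 by simp
      show "m2 (100 + j) = of_bool (Suc j \<in> T)" if "j < n" for j
        using m2[of j] that encode_target[OF that] by simp
      fix k assume k: "k < length fs"
      show "m2 (row k) = rhs k" using r[OF k, of 0] by simp
      show "m2 (row k + Suc j) = of_bool (Suc j \<in> lhs k)" if "j < n" for j
        using r[OF k, of "Suc j"] that char_vector_nth[OF that] by simp
    qed
    then show ?case using Q 6 by simp
  qed (use 6 N in \<open>simp_all add: regs_def\<close>)
qed (simp_all add: encode_def length_le)

end

text \<open>The length of the encoding exceeds by 2 the largest loop counter, that of the copying
  loop, so it can serve as the bound on all counters.\<close>

lemma wp_greedy:
  assumes inst: "tcand_instance n (set fs) T" and "distinct fs"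
    and Q: "\<And>U X xs. greedy_inv n (set fs) T 0 U X \<Longrightarrow> set xs = X \<union> U \<Longrightarrow> Q xs"
  shows "wp (length (encode n fs T)) greedy (\<lambda>m i. Q) (\<lambda>_. 0) (encode n fs T) []"
proof -
  let ?N = "length (encode n fs T)"
  interpret greedy_machine n ?N fs
    by unfold_locales (use assms(1,2) in \<open>auto simp: tcand_instance_def length_encode\<close>)
  show ?thesis
    unfolding greedy_def wp.simps(2)[of _ read_input]
  proof (rule wp_read_input[where T = T])
    show "n + length fs * (n + 1) \<le> ?N" by (simp add: length_encode)
    fix m i assume "holds m T"
    then show "wp ?N (Blk [Add R_t R_n R_zero] ;; For R_t (select_best ;; choose_best) ;;
        Blk [Add R_p R_base1 R_zero] ;; print_marked) (\<lambda>m i. Q) m i []"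
      by (rule wp_main[OF inst]) (rule Q)
  qed
qed

theorem theorem6:
  "\<exists>c::real. c > 0 \<and> (\<exists>P :: program.
     polynomial_time_on tcand_inputs P \<and>
     whp_approximation (\<lambda>n F T. c * (real (Delta F) + 1) * ln (real n)) P)"
proof (intro exI conjI)
  let ?P = "compile greedy 0"
  show "(0::real) < 4" by simp
  have wp: "wp (length (encode n fs T)) greedy
      (\<lambda>m i xs. \<exists>U X. greedy_inv n (set fs) T 0 U X \<and> set xs = X \<union> U) (\<lambda>_. 0) (encode n fs T) []"
    if "tcand_instance n (set fs) T" "distinct fs" for n fs T
    by (rule wp_greedy[OF that]) blast
  show "polynomial_time_on tcand_inputs ?P"
    unfolding polynomial_time_on_def
  proof (intro exI ballI)
    fix w assume "w \<in> tcand_inputs"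
    then obtain n fs T where "w = encode n fs T" "tcand_instance n (set fs) T" "distinct fs"
      by (auto simp: tcand_inputs_def encodings_def)
    then show "halts_within ?P w (poly (time_bound greedy) (length w))"
      using wp_compile(1)[OF wp] by blast
  qed
  show "whp_approximation (\<lambda>n F T. 4 * (real (Delta F) + 1) * ln (real n)) ?P"
    unfolding whp_approximation_def
  proof (intro exI conjI allI impI ballI)
    \<comment> \<open>For \<open>n\<close> equal to 0 or 1 the logarithm is 0 and the bound may
      fail, so the failure probability is set to 1 there. From 2 on it is 0, as the algorithm is
      deterministic.\<close>
    let ?d = "\<lambda>n. of_bool (n < 2) :: real"
    have "eventually (\<lambda>n. ?d n = 0) sequentially"
      using eventually_ge_at_top[of 2] by eventually_elim simp
    then show "?d \<longlonglongrightarrow> 0" by (rule tendsto_eventually)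
    fix n F T w assume inst: "tcand_instance n F T" and "w \<in> encodings n F T"
    then obtain fs where w: "w = encode n fs T" "distinct fs" "F = set fs"
      by (auto simp: encodings_def)
    let ?A = "{xs. feasible n F T (set xs) \<and>
      real (card (set xs)) \<le> 4 * (real (Delta F) + 1) * ln (real n) * real (OPT n F T)}"
    show "1 - ?d n \<le> measure_pmf.prob (output_distribution ?P w) ?A"
    proof (cases "n < 2")
      case False
      obtain xs U X where "greedy_inv n F T 0 U X" "set xs = X \<union> U"
        and out: "output_distribution ?P w = return_pmf xs"
        using wp_compile(2)[OF wp[of n fs T]] inst w by auto
      then have "xs \<in> ?A" using greedy_inv_final[OF inst, of U X] False by simp
      then show ?thesis unfolding out by simp
    qed simp
  qed
qed

end
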